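(* Let $\mathcal A$ be a unital Banach algebra with a periodic ($d$-parameter) automorphism group $\Psi$, and let $M=(M_k)_{k\ge0}$ be a sequence of positive numbers with $M_0=1$ satisfying condition (M2'): there exist constants $c>0$, $h>1$ with $M_{k+1}\le c\,h^kM_k$ for all $k$. Then $$C_M(\mathcal A)=\bigcup_{r>0}\mathcal C^1_{T_{r,M}}(\mathcal A)=\bigcup_{r>0}\mathcal C^\infty_{T_{r,M}}(\mathcal A)=\bigcup_{r>0}\mathcal E^\infty_{T_{r,M}}(\mathcal A),$$ with the interpretation that these algebras, equipped with their natural inductive limit topologies, are topologically isomorphic.
   Context: A $d$-parameter automorphism group $\Psi=\{\psi_t\}_{t\in\mathbb R^d}$ on $\mathcal A$ is a family of Banach algebra automorphisms with $\psi_s\psi_t=\psi_{s+t}$ and $\sup_t\|\psi_t\|_{\mathcal A\to\mathcal A}<\infty$; it is periodic if $\psi_{t+e_j}=\psi_t$ for all $t$ and $1\le j\le d$. $C(\mathcal A)$ is the set of $a\in\mathcal A$ with $\psi_t(a)\to a$ in norm as $t\to0$. The generators $\delta_j(a)=\lim_{h\to0}(\psi_{he_j}(a)-a)/h$ (domain: those $a$ for which the norm limit exists) are closed derivations, and $\delta^\alpha=\delta_1^{\alpha_1}\cdots\delta_d^{\alpha_d}$ for $\alpha\in\mathbb N_0^d$, $|\alpha|=\sum_j\alpha_j$. $C_{r,M}(\mathcal A)$ ($r>0$) is the Banach space of $a\in\mathcal A$ (with all $\delta^\alpha(a)$ defined) with finite norm $\sup_{\alpha\in\mathbb N_0^d}\frac{\|\delta^\alpha(a)\|_{\mathcal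 A}}{r^{|\alpha|}M_{|\alpha|}}$, and $C_M(\mathcal A)=\bigcup_{r>0}C_{r,M}(\mathcal A)$ with the inductive limit topology. The function associated to $M$ is $T_M(u)=\sup_{k\ge0}u^k/M_k$ (with $0^0=1$), and $T_{r,M}(k)=T_M(2\pi|k|_\infty/r)$ for $k\in\mathbb Z^d$ or $k\in\mathbb N_0$. Fourier coefficients of $a\in C(\mathcal A)$ are $\hat a(k)=\int_{\mathbb T^d}\psi_t(a)e^{-2\pi i k\cdot t}\,dt$, $k\in\mathbb Z^d$, $\mathbb T^d=\mathbb R^d/\mathbb Z^d$. For a weight $v$ on $\mathbb Z^d$, $\mathcal C^1_v(\mathcal A)$ (resp. $\mathcal C^\infty_v(\mathcal A)$) is the space of $a\in C(\mathcal A)$ with finite norm $\sum_k\|\hat a(k)\|_{\mathcal A}v(k)$ (resp. $\sup_k\|\hat a(k)\|_{\mathcal A}v(k)$). An element $a\in\mathcal A$ is $\sigma$-bandlimited ($\sigma>0$) if there is $C$ with $\|\delta^\alpha(a)\|_{\mathcal A}\le C(2\pi\sigma)^{|\alpha|}$ for all $\alpha\in\mathbb N_0^d$. Put $X_0=\{0\}$, $X_n=\{a\in\mathcal A: a\text{ is }n\text{-bandlimited}\}$ for $n\ge1$, and $E_n(a)=\inf_{x\in X_n}\|a-x\|_{\mathcal A}$. For a weight $w$ on $\mathbb N_0$, $\mathcal E^\infty_w(\mathcal A)$ is the space of $a\in\mathcal A$ with finite norm $\sup_{n\ge0}E_n(a)w(n)$.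
   Formalization: It is additionally assumed that T_M(u) is finite for some u>0; otherwise T_{r,M} is infinite off 0 and not a weight, and for M_k=1/k! the claim fails: for translations on C(T), e^{2πit} lies in the approximation space but not in C_M. *)

theory Defs
  imports "HOL-Analysis.Analysis"
begin

section \<open>Complex unital Banach algebras\<close>

(* The norm of the unit is not required to be 1. *)

class complex_banach_algebra_1 = real_normed_algebra + real_algebra_1 + banach +
  fixes scaleC :: "complex \<Rightarrow> 'a \<Rightarrow> 'a"
  assumes scaleC_add_right: "scaleC c (x + y) = scaleC c x + scaleC c y"
    and scaleC_add_left: "scaleC (c + d) x = scaleC c x + scaleC d x"
    and scaleC_scaleC: "scaleC c (scaleC d x) = scaleC (c * d) x"
    and scaleC_of_real: "scaleC (complex_of_real r) x = r *\<^sub>R x"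
    and scaleC_mult_left: "scaleC c x * y = scaleC c (x * y)"
    and scaleC_mult_right: "x * scaleC c y = scaleC c (x * y)"
    and norm_scaleC: "norm (scaleC c x) = cmod c * norm x"

section \<open>Automorphism groups and their generators\<close>

definition banach_algebra_automorphism :: "('a::complex_banach_algebra_1 \<Rightarrow> 'a) \<Rightarrow> bool" where
  "banach_algebra_automorphism f \<longleftrightarrow>
     bij f \<and> bounded_linear f \<and> (\<forall>c x. f (scaleC c x) = scaleC c (f x)) \<and>
     (\<forall>x y. f (x * y) = f x * f y)"

(* No continuity in t is assumed. *)
definition automorphism_group :: "(real^'d \<Rightarrow> 'a::complex_banach_algebra_1 \<Rightarrow> 'a) \<Rightarrow> bool" where
  "automorphism_group \<psi> \<longleftrightarrow>
     (\<forall>t. banach_algebra_automorphism (\<psi> t)) \<and>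
     (\<forall>s t. \<psi> s \<circ> \<psi> t = \<psi> (s + t)) \<and>
     bdd_above (range (\<lambda>t. onorm (\<psi> t)))"

definition periodic_group :: "(real^'d \<Rightarrow> 'a \<Rightarrow> 'a) \<Rightarrow> bool" where
  "periodic_group \<psi> \<longleftrightarrow> (\<forall>t j. \<psi> (t + axis j 1) = \<psi> t)"

definition continuous_elements :: "(real^'d \<Rightarrow> 'a::complex_banach_algebra_1 \<Rightarrow> 'a) \<Rightarrow> 'a set" where
  "continuous_elements \<psi> = {a. ((\<lambda>t. \<psi> t a) \<longlongrightarrow> a) (at 0)}"

definition generator_dom ::
    "(real^'d \<Rightarrow> 'a::complex_banach_algebra_1 \<Rightarrow> 'a) \<Rightarrow> 'd \<Rightarrow> 'a set" where
  "generator_dom \<psi> j = {a. \<exists>b. ((\<lambda>h::real. (1 / h) *\<^sub>R (\<psi> (h *\<^sub>R axis j 1) a - a)) \<longlongrightarrow> b) (at 0)}"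

definition generator ::
    "(real^'d \<Rightarrow> 'a::complex_banach_algebra_1 \<Rightarrow> 'a) \<Rightarrow> 'd \<Rightarrow> 'a \<Rightarrow> 'a" where
  "generator \<psi> j a = Lim (at 0) (\<lambda>h::real. (1 / h) *\<^sub>R (\<psi> (h *\<^sub>R axis j 1) a - a))"

(* Compositions of the (unbounded) generators along a word of indices, rightmost factor first,
   with the natural domain of a composition of partial operators. *)
primrec generator_word ::
    "(real^'d \<Rightarrow> 'a::complex_banach_algebra_1 \<Rightarrow> 'a) \<Rightarrow> 'd list \<Rightarrow> 'a \<Rightarrow> 'a" where
  "generator_word \<psi> [] a = a"
| "generator_word \<psi> (j # js) a = generator \<psi> j (generator_word \<psi> js a)"

primrec generator_word_dom ::
    "(real^'d \<Rightarrow> 'a::complex_banach_algebra_1 \<Rightarrow> 'a) \<Rightarrow> 'd list \<Rightarrow> 'a set" where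
  "generator_word_dom \<psi> [] = UNIV"
| "generator_word_dom \<psi> (j # js) =
     {a \<in> generator_word_dom \<psi> js. generator_word \<psi> js a \<in> generator_dom \<psi> j}"

(* The linear order on the index type plays the role of the order 1, ..., d of the coordinates:
   the word lists the first coordinate (alpha 1) times, ..., the last one (alpha d) times. *)
definition multi_word :: "('d::{finite,linorder} \<Rightarrow> nat) \<Rightarrow> 'd list" where
  "multi_word \<alpha> = concat (map (\<lambda>j. replicate (\<alpha> j) j) (sorted_list_of_set UNIV))"

definition multi_deriv ::
    "(real^'d::{finite,linorder} \<Rightarrow> 'a::complex_banach_algebra_1 \<Rightarrow> 'a) \<Rightarrow> ('d \<Rightarrow> nat) \<Rightarrow> 'a \<Rightarrow> 'a" where
  "multi_deriv \<psi> \<alpha> = generator_word \<psi> (multi_word \<alpha>)"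

definition multi_deriv_dom ::
    "(real^'d::{finite,linorder} \<Rightarrow> 'a::complex_banach_algebra_1 \<Rightarrow> 'a) \<Rightarrow> ('d \<Rightarrow> nat) \<Rightarrow> 'a set" where
  "multi_deriv_dom \<psi> \<alpha> = generator_word_dom \<psi> (multi_word \<alpha>)"

abbreviation multi_order :: "('d::finite \<Rightarrow> nat) \<Rightarrow> nat" where
  "multi_order \<alpha> \<equiv> \<Sum>j\<in>UNIV. \<alpha> j"

definition smooth_elements ::
    "(real^'d::{finite,linorder} \<Rightarrow> 'a::complex_banach_algebra_1 \<Rightarrow> 'a) \<Rightarrow> 'a set" where
  "smooth_elements \<psi> = (\<Inter>\<alpha>. multi_deriv_dom \<psi> \<alpha>)"

section \<open>Inductive limits of normed subspaces\<close>

(* A normed subspace of 'a is encoded by an extended norm N on all of 'a, which takes the value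
   infinity exactly outside the subspace. *)
definition finite_part :: "('a \<Rightarrow> ennreal) \<Rightarrow> 'a set" where
  "finite_part N = {a. N a < \<infinity>}"

definition norm_topology :: "('a::ab_group_add \<Rightarrow> ennreal) \<Rightarrow> 'a topology" where
  "norm_topology N = Metric_space.mtopology (finite_part N) (\<lambda>x y. enn2real (N (x - y)))"

(* Locally convex (not necessarily Hausdorff) complex vector space topologies on a subspace E;
   that E is a subspace is part of the continuity of the two operations. *)
definition locally_convex_topology :: "'a::complex_banach_algebra_1 set \<Rightarrow> 'a topology \<Rightarrow> bool" where
  "locally_convex_topology E T \<longleftrightarrow>
     topspace T = E \<and>
     continuous_map (prod_topology T T) T (\<lambda>(x, y). x + y) \<and>
     continuous_map (prod_topology euclidean T) T (\<lambda>(c, x). scaleC c x) \<and>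
     (\<forall>W x. openin T W \<and> x \<in> W \<longrightarrow> (\<exists>U. openin T U \<and> convex U \<and> x \<in> U \<and> U \<subseteq> W))"

(* The finest locally convex topology on the union for which all inclusions are continuous,
   as the supremum of all such topologies. *)
definition inductive_limit_topology ::
    "'i set \<Rightarrow> ('i \<Rightarrow> 'a::complex_banach_algebra_1 \<Rightarrow> ennreal) \<Rightarrow> 'a topology" where
  "inductive_limit_topology I N = topology_generated_by
     {U. \<exists>T. locally_convex_topology (\<Union>i\<in>I. finite_part (N i)) T \<and>
             (\<forall>i\<in>I. continuous_map (norm_topology (N i)) T id) \<and> openin T U}"

section \<open>Carleman classes\<close>

definition carleman_norm ::
    "(real^'d::{finite,linorder} \<Rightarrow> 'a::complex_banach_algebra_1 \<Rightarrow> 'a) \<Rightarrow> (nat \<Rightarrow> real) \<Rightarrow> real \<Rightarrow>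
     'a \<Rightarrow> ennreal" where
  "carleman_norm \<psi> M r a =
     (if a \<in> smooth_elements \<psi>
      then SUP \<alpha>. ennreal (norm (multi_deriv \<psi> \<alpha> a) / (r ^ multi_order \<alpha> * M (multi_order \<alpha>)))
      else \<infinity>)"

definition carleman_class ::
    "(real^'d::{finite,linorder} \<Rightarrow> 'a::complex_banach_algebra_1 \<Rightarrow> 'a) \<Rightarrow> (nat \<Rightarrow> real) \<Rightarrow> 'a set" where
  "carleman_class \<psi> M = (\<Union>r\<in>{0<..}. finite_part (carleman_norm \<psi> M r))"

section \<open>The associated function and its weights\<close>

(* The supremum may be infinite. Below, weights multiply norms in ennreal, where 0 * \<infinity> = 0:
   an infinite weight at k forces the k-th term to vanish. If assoc_fun M u = \<infinity> for every u > 0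
   (e.g. M k = 1 / fact k), all weights are infinite off 0; in that degenerate case the
   approximation spaces contain all 1-bandlimited elements, but the Fourier spaces only the
   elements whose Fourier coefficients vanish off 0. *)
definition assoc_fun :: "(nat \<Rightarrow> real) \<Rightarrow> real \<Rightarrow> ennreal" where
  "assoc_fun M u = (SUP k. ennreal (u ^ k / M k))"

definition sup_norm_int :: "int^'d \<Rightarrow> real" where
  "sup_norm_int k = real_of_int (Max (range (\<lambda>j. \<bar>k $ j\<bar>)))"

definition lattice_weight :: "(nat \<Rightarrow> real) \<Rightarrow> real \<Rightarrow> int^'d \<Rightarrow> ennreal" where
  "lattice_weight M r k = assoc_fun M (2 * pi * sup_norm_int k / r)"

definition nat_weight :: "(nat \<Rightarrow> real) \<Rightarrow> real \<Rightarrow> nat \<Rightarrow> ennreal" where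
  "nat_weight M r n = assoc_fun M (2 * pi * real n / r)"

section \<open>Weighted Fourier coefficients\<close>

definition fourier_coeff ::
    "(real^'d \<Rightarrow> 'a::complex_banach_algebra_1 \<Rightarrow> 'a) \<Rightarrow> 'a \<Rightarrow> int^'d \<Rightarrow> 'a" where
  "fourier_coeff \<psi> a k =
     integral (cbox 0 (\<chi> j. 1))
       (\<lambda>t. scaleC (cis (- (2 * pi * (\<Sum>j\<in>UNIV. real_of_int (k $ j) * t $ j)))) (\<psi> t a))"

definition fourier_norm_1 ::
    "(real^'d \<Rightarrow> 'a::complex_banach_algebra_1 \<Rightarrow> 'a) \<Rightarrow> (int^'d \<Rightarrow> ennreal) \<Rightarrow> 'a \<Rightarrow> ennreal" where
  "fourier_norm_1 \<psi> v a =
     (if a \<in> continuous_elements \<psi>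
      then \<Sum>\<^sub>\<infinity>k\<in>UNIV. ennreal (norm (fourier_coeff \<psi> a k)) * v k else \<infinity>)"

definition fourier_norm_sup ::
    "(real^'d \<Rightarrow> 'a::complex_banach_algebra_1 \<Rightarrow> 'a) \<Rightarrow> (int^'d \<Rightarrow> ennreal) \<Rightarrow> 'a \<Rightarrow> ennreal" where
  "fourier_norm_sup \<psi> v a =
     (if a \<in> continuous_elements \<psi>
      then SUP k. ennreal (norm (fourier_coeff \<psi> a k)) * v k else \<infinity>)"

section \<open>Approximation by bandlimited elements\<close>

definition bandlimited ::
    "(real^'d::{finite,linorder} \<Rightarrow> 'a::complex_banach_algebra_1 \<Rightarrow> 'a) \<Rightarrow> real \<Rightarrow> 'a \<Rightarrow> bool" where
  "bandlimited \<psi> \<sigma> a \<longleftrightarrow>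
     a \<in> smooth_elements \<psi> \<and>
     (\<exists>C. \<forall>\<alpha>. norm (multi_deriv \<psi> \<alpha> a) \<le> C * (2 * pi * \<sigma>) ^ multi_order \<alpha>)"

definition bandlimited_space ::
    "(real^'d::{finite,linorder} \<Rightarrow> 'a::complex_banach_algebra_1 \<Rightarrow> 'a) \<Rightarrow> nat \<Rightarrow> 'a set" where
  "bandlimited_space \<psi> n = (if n = 0 then {0} else {a. bandlimited \<psi> (real n) a})"

definition approx_error ::
    "(real^'d::{finite,linorder} \<Rightarrow> 'a::complex_banach_algebra_1 \<Rightarrow> 'a) \<Rightarrow> nat \<Rightarrow> 'a \<Rightarrow> real" where
  "approx_error \<psi> n a = (INF x\<in>bandlimited_space \<psi> n. norm (a - x))"

definition approx_norm_sup ::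
    "(real^'d::{finite,linorder} \<Rightarrow> 'a::complex_banach_algebra_1 \<Rightarrow> 'a) \<Rightarrow> (nat \<Rightarrow> ennreal) \<Rightarrow>
     'a \<Rightarrow> ennreal" where
  "approx_norm_sup \<psi> w a = (SUP n. ennreal (approx_error \<psi> n a) * w n)"

section \<open>The inductive limit topology is as intended\<close>

lemma topology_generated_by_opens:
  assumes "openin T U" "\<And>V. openin T V \<Longrightarrow> V \<in> S"
  shows "openin (topology_generated_by S) U"
  by (simp add: assms topology_generated_by_Basis)

lemma locally_convex_indiscrete:
  assumes "\<And>x y. x \<in> E \<Longrightarrow> y \<in> E \<Longrightarrow> x + y \<in> E" "\<And>c x. x \<in> E \<Longrightarrow> scaleC c x \<in> E"
  shows "locally_convex_topology E (topology_generated_by {E})"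
proof -
  have op: "openin (topology_generated_by {E}) U \<longleftrightarrow> U = {} \<or> U = E" for U
  proof
    assume "openin (topology_generated_by {E}) U"
    then have "generate_topology_on {E} U"
      by (simp add: openin_topology_generated_by_iff)
    then show "U = {} \<or> U = E"
      by (induction rule: generate_topology_on.induct) auto
  next
    assume "U = {} \<or> U = E"
    then show "openin (topology_generated_by {E}) U"
      by (auto intro: topology_generated_by_Basis)
  qed
  have top: "topspace (topology_generated_by {E}) = E"
    by simp
  have conv: "convex E"
    using assms by (auto simp: convex_def scaleC_of_real[symmetric])
  have cont: "continuous_map X (topology_generated_by {E}) f" if "f \<in> topspace X \<rightarrow> E"
    for X :: "'b topology" and f
  proof -
    have "{x \<in> topspace X. f x \<in> E} = topspace X"
      using that by auto
    then show ?thesis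
      using that unfolding continuous_map_def by (auto simp: op top)
  qed
  show ?thesis
    unfolding locally_convex_topology_def
  proof (intro conjI allI impI)
    show "topspace (topology_generated_by {E}) = E" by (rule top)
    show "continuous_map (prod_topology (topology_generated_by {E}) (topology_generated_by {E}))
            (topology_generated_by {E}) (\<lambda>(x, y). x + y)"
      by (rule cont) (auto simp: assms)
    show "continuous_map (prod_topology euclidean (topology_generated_by {E}))
            (topology_generated_by {E}) (\<lambda>(c, x). scaleC c x)"
      by (rule cont) (auto simp: assms)
    show "\<exists>U. openin (topology_generated_by {E}) U \<and> convex U \<and> x \<in> U \<and> U \<subseteq> W"
      if "openin (topology_generated_by {E}) W \<and> x \<in> W" for W x
      using that conv by (auto simp: op)
  qed
qed

context
  fixes I :: "'i set" and N :: "'i \<Rightarrow> 'a::complex_banach_algebra_1 \<Rightarrow> ennreal" and E :: "'a set"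
  defines "E \<equiv> (\<Union>i\<in>I. finite_part (N i))"
  assumes add_closed: "\<And>x y. x \<in> E \<Longrightarrow> y \<in> E \<Longrightarrow> x + y \<in> E"
    and scale_closed: "\<And>c x. x \<in> E \<Longrightarrow> scaleC c x \<in> E"
    and metric: "\<And>i. i \<in> I \<Longrightarrow> Metric_space (finite_part (N i)) (\<lambda>x y. enn2real (N i (x - y)))"
begin

private definition admissible :: "'a topology \<Rightarrow> bool" where
  "admissible T \<longleftrightarrow> locally_convex_topology E T \<and>
     (\<forall>i\<in>I. continuous_map (norm_topology (N i)) T id)"

private definition subbase :: "'a set set" where
  "subbase = {U. \<exists>T. admissible T \<and> openin T U}"

private lemma limit_eq: "inductive_limit_topology I N = topology_generated_by subbase"
  unfolding inductive_limit_topology_def subbase_def admissible_def E_def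
  by (simp add: conj_assoc)

private lemma topspace_norm_topology: "i \<in> I \<Longrightarrow> topspace (norm_topology (N i)) = finite_part (N i)"
  unfolding norm_topology_def by (rule Metric_space.topspace_mtopology[OF metric])

private lemma admissible_indiscrete: "admissible (topology_generated_by {E})"
  unfolding admissible_def
proof (intro conjI ballI)
  show "locally_convex_topology E (topology_generated_by {E})"
    by (rule locally_convex_indiscrete[OF add_closed scale_closed])
  show "continuous_map (norm_topology (N i)) (topology_generated_by {E}) id" if "i \<in> I" for i
  proof (rule continuous_on_generated_topo)
    show "openin (norm_topology (N i)) (id -` U \<inter> topspace (norm_topology (N i)))"
      if "U \<in> {E}" for U
    proof -
      have "id -` U \<inter> topspace (norm_topology (N i)) = topspace (norm_topology (N i))"
        using that \<open>i \<in> I\<close> by (auto simp: topspace_norm_topology E_def)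
      then show ?thesis by simp
    qed
    show "id ` topspace (norm_topology (N i)) \<subseteq> \<Union> {E}"
      using \<open>i \<in> I\<close> by (auto simp: topspace_norm_topology E_def)
  qed
qed

private lemma admissible_topspace: "admissible T \<Longrightarrow> topspace T = E"
  by (simp add: admissible_def locally_convex_topology_def)

private lemma Union_subbase: "\<Union> subbase = E"
proof
  show "\<Union> subbase \<subseteq> E"
    using admissible_topspace openin_subset by (fastforce simp: subbase_def)
  have "E \<in> subbase"
    using admissible_indiscrete unfolding subbase_def
    by (auto intro!: exI[of _ "topology_generated_by {E}"] topology_generated_by_Basis)
  then show "E \<subseteq> \<Union> subbase" by blast
qed

lemma topspace_inductive_limit: "topspace (inductive_limit_topology I N) = E"
  by (simp add: limit_eq Union_subbase)

private lemma coarser: "admissible T \<Longrightarrow> openin T U \<Longrightarrow> openin (inductive_limit_topology I N) U"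
  unfolding limit_eq by (rule topology_generated_by_Basis) (auto simp: subbase_def)

lemma inductive_limit_finest:
  assumes "locally_convex_topology E T" "\<And>i. i \<in> I \<Longrightarrow> continuous_map (norm_topology (N i)) T id"
    and "openin T U"
  shows "openin (inductive_limit_topology I N) U"
  using assms coarser by (auto simp: admissible_def)

private lemma to_admissible:
  assumes "admissible T"
  shows "continuous_map (inductive_limit_topology I N) T id"
  unfolding continuous_map_def
proof (intro conjI allI impI)
  show "id \<in> topspace (inductive_limit_topology I N) \<rightarrow> topspace T"
    by (simp add: topspace_inductive_limit admissible_topspace[OF assms])
  fix U assume U: "openin T U"
  then have "{x \<in> topspace (inductive_limit_topology I N). id x \<in> U} = U"
    using openin_subset[OF U] by (auto simp: topspace_inductive_limit admissible_topspace[OF assms])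
  then show "openin (inductive_limit_topology I N) {x \<in> topspace (inductive_limit_topology I N). id x \<in> U}"
    using coarser[OF assms U] by simp
qed

private lemma into_limit:
  assumes "\<And>T. admissible T \<Longrightarrow> continuous_map X T f" 
  shows "continuous_map X (inductive_limit_topology I N) f"
  unfolding limit_eq
proof (rule continuous_on_generated_topo)
  show "openin X (f -` U \<inter> topspace X)" if U: "U \<in> subbase" for U
  proof -
    obtain T where T: "admissible T" "openin T U"
      using U by (auto simp: subbase_def)
    have "f -` U \<inter> topspace X = {x \<in> topspace X. f x \<in> U}" by auto
    then show ?thesis
      using assms[OF T(1)] T(2) by (simp add: continuous_map_def)
  qed
  show "f ` topspace X \<subseteq> \<Union> subbase"
    using assms[OF admissible_indiscrete] admissible_topspace[OF admissible_indiscrete]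
    unfolding Union_subbase continuous_map_def by auto
qed

lemma inductive_limit_inclusion:
  "i \<in> I \<Longrightarrow> continuous_map (norm_topology (N i)) (inductive_limit_topology I N) id"
  by (rule into_limit) (auto simp: admissible_def)

lemma inductive_limit_locally_convex: "locally_convex_topology E (inductive_limit_topology I N)"
  unfolding locally_convex_topology_def
proof (intro conjI allI impI)
  let ?L = "inductive_limit_topology I N"
  show "topspace ?L = E" by (rule topspace_inductive_limit)
  show "continuous_map (prod_topology ?L ?L) ?L (\<lambda>(x, y). x + y)"
  proof (rule into_limit)
    fix T assume T: "admissible T"
    have 1: "continuous_map (prod_topology ?L ?L) (prod_topology T T) (\<lambda>(x, y). (id x, id y))"
      by (intro continuous_map_prod_top[THEN iffD2] disjI2 conjI to_admissible[OF T] continuous_map_id)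
    have 2: "continuous_map (prod_topology T T) T (\<lambda>(x, y). x + y)"
      using T by (simp add: admissible_def locally_convex_topology_def)
    show "continuous_map (prod_topology ?L ?L) T (\<lambda>(x, y). x + y)"
      using continuous_map_compose[OF 1 2] by (simp add: comp_def case_prod_unfold)
  qed
  show "continuous_map (prod_topology euclidean ?L) ?L (\<lambda>(c, x). scaleC c x)"
  proof (rule into_limit)
    fix T assume T: "admissible T"
    have 1: "continuous_map (prod_topology euclidean ?L) (prod_topology euclidean T)
            (\<lambda>(c, x). (id c :: complex, id x))"
      by (intro continuous_map_prod_top[THEN iffD2] disjI2 conjI to_admissible[OF T] continuous_map_id)
    have 2: "continuous_map (prod_topology euclidean T) T (\<lambda>(c, x). scaleC c x)"
      using T by (simp add: admissible_def locally_convex_topology_def)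
    show "continuous_map (prod_topology euclidean ?L) T (\<lambda>(c, x). scaleC c x)"
      using continuous_map_compose[OF 1 2] by (simp add: comp_def case_prod_unfold)
  qed
  fix W x assume W: "openin ?L W \<and> x \<in> W"
  then have "generate_topology_on subbase W"
    by (simp add: limit_eq openin_topology_generated_by_iff)
  then have "x \<in> W \<Longrightarrow> \<exists>U. openin ?L U \<and> convex U \<and> x \<in> U \<and> U \<subseteq> W"
  proof (induction rule: generate_topology_on.induct)
    case Empty
    then show ?case by simp
  next
    case (Int a b)
    then have x: "x \<in> a" "x \<in> b" by auto
    obtain U where U: "openin ?L U \<and> convex U \<and> x \<in> U \<and> U \<subseteq> a"
      using Int(3)[OF x(1)] by (elim exE)
    obtain V where V: "openin ?L V \<and> convex V \<and> x \<in> V \<and> V \<subseteq> b"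
      using Int(4)[OF x(2)] by (elim exE)
    show ?case
      using U V by (intro exI[of _ "U \<inter> V"]) (auto intro: convex_Int)
  next
    case (UN K)
    then obtain k where k: "k \<in> K" "x \<in> k" by auto
    obtain U where "openin ?L U \<and> convex U \<and> x \<in> U \<and> U \<subseteq> k"
      using UN(2)[OF k] by (elim exE)
    then show ?case
      using k(1) by (intro exI[of _ U]) auto
  next
    case (Basis s)
    then obtain T where T: "admissible T" "openin T s" by (auto simp: subbase_def)
    have "\<forall>W x. openin T W \<and> x \<in> W \<longrightarrow> (\<exists>U. openin T U \<and> convex U \<and> x \<in> U \<and> U \<subseteq> W)"
      using T(1) unfolding admissible_def locally_convex_topology_def by (elim conjE)
    then obtain U where U: "openin T U" "convex U" "x \<in> U" "U \<subseteq> s"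
      using T(2) Basis(2) by meson
    show ?case
      using coarser[OF T(1) U(1)] U(2-4) by (intro exI[of _ U] conjI)
  qed
  then show "\<exists>U. openin ?L U \<and> convex U \<and> x \<in> U \<and> U \<subseteq> W" using W by simp
qed

end

end

(* All four families of norms are compared with the Fourier coefficients, which are eigenvectors
   of the group: psi_t acts on the k-th one by exp(2 pi i k.t) and delta^alpha by (2 pi i k)^alpha.
   Boundedness of the group gives C^infinity-norm <= C * Carleman norm, and, since n-bandlimited
   elements have no coefficients beyond n, C^infinity-norm <= C * approximation norm. Condition
   (M2') says that u T_M(u) <= C T_M(hu), so passing to a larger r absorbs any summable polynomial
   factor and C^1-norm <= C * C^infinity-norm. Finally, if the C^1-norm is finite, the Fourier series
   converges to the element and may be differentiated termwise, which bounds the Carleman norm;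
   its partial sums are bandlimited, which bounds the approximation norm. That the series
   represents the element rests on uniqueness of Fourier coefficients, proved with the kernels
   prod_j ((1 + cos 2 pi t_j) / 2)^n. *)
theory Submission
  imports Defs
begin

section \<open>Complex scalars and the character group of the torus\<close>

text \<open>The hypothesis that T_M is finite at some u > 0 excludes the degenerate case in which
  all weights off 0 are infinite. It enters at frequencies of norm 1: a coefficient with |k| = m is
  seen only by the errors E_n with n < m, so m = 1 leaves just E_0, whose weight T_M(0) = 1 says
  nothing about T_M elsewhere. For m \<ge> 2 the passage from m to m - 1 costs at most a factor 2 in
  r. The group is not assumed strongly continuous, so a finite Carleman or approximation norm must
  first be shown to force membership in C(A), where Fourier coefficients are well behaved. Smooth
  elements get there one coordinate at a time; the approximation norm uses that C(A) is closed, a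
  consequence of the uniform bound on the group. The kernels are powers of a trigonometric
  polynomial with values in [0, 1] that equals 1 on the unit cube only at the corners. Multiplying
  by one factor merely mixes neighbouring frequencies, so neither explicit kernel coefficients nor a
  normalisation is required. Estimates N'_s \<le> C N_r, with s depending on r, in both directions
  admit the same locally convex topologies; the limit topologies are thus equal, with the identity
  as isomorphism.\<close>

lemma bounded_bilinear_scaleC: "bounded_bilinear (scaleC :: complex \<Rightarrow> 'a::complex_banach_algebra_1 \<Rightarrow> 'a)"
proof
  show "\<exists>K. \<forall>c (x::'a). norm (scaleC c x) \<le> norm c * norm x * K"
    by (intro exI[of _ 1]) (simp add: norm_scaleC)
  show "scaleC (r *\<^sub>R c) x = r *\<^sub>R scaleC c x" for r c and x :: 'a
    using scaleC_scaleC[of "of_real r" c x] scaleC_of_real[of r "scaleC c x"]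
    by (simp add: scaleR_conv_of_real[of r c])
  show "scaleC c (r *\<^sub>R x) = r *\<^sub>R scaleC c x" for r c and x :: 'a
    by (simp add: scaleC_scaleC mult.commute flip: scaleC_of_real)
qed (simp_all add: scaleC_add_left scaleC_add_right)

lemmas bounded_linear_scaleC_right = bounded_bilinear.bounded_linear_right[OF bounded_bilinear_scaleC]
lemmas continuous_on_scaleC [continuous_intros] =
  bounded_bilinear.continuous_on[OF bounded_bilinear_scaleC]
lemmas tendsto_scaleC [tendsto_intros] = bounded_bilinear.tendsto[OF bounded_bilinear_scaleC]

lemma scaleC_one [simp]: "scaleC 1 x = (x::'a::complex_banach_algebra_1)"
  using scaleC_of_real[of 1 x] by simp

lemma scaleC_zero_left [simp]: "scaleC 0 x = (0::'a::complex_banach_algebra_1)"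
  using scaleC_of_real[of 0 x] by simp

definition character :: "int^'d \<Rightarrow> real^'d \<Rightarrow> complex" where
  "character k t = cis (2 * pi * (\<Sum>j\<in>UNIV. real_of_int (k $ j) * t $ j))"

lemma character_add: "character k (s + t) = character k s * character k t"
  by (simp add: character_def cis_mult algebra_simps sum.distrib)

lemma character_add_index: "character (k + l) t = character k t * character l t"
  by (simp add: character_def cis_mult algebra_simps sum.distrib)

lemma character_zero [simp]: "character k 0 = 1"
  and character_zero_index [simp]: "character 0 t = 1"
  by (simp_all add: character_def)

lemma norm_character [simp]: "cmod (character k t) = 1"
  by (simp add: character_def)

lemma character_scaled_axis: "character k (h *\<^sub>R axis j 1) = cis (2 * pi * real_of_int (k $ j) * h)"
proof -
  have "(\<Sum>i\<in>UNIV. real_of_int (k $ i) * (h *\<^sub>R axis j (1::real)) $ i) = real_of_int (k $ j) * h"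
    by (subst sum.remove[of _ j]) (auto simp: axis_def intro!: sum.neutral)
  then show ?thesis by (simp add: character_def mult.assoc)
qed

lemma character_axis [simp]: "character k (axis j 1) = 1"
  using character_scaled_axis[of k 1 j] by (simp add: cis_multiple_2pi)

lemma character_uminus: "character (- k) t = cis (- (2 * pi * (\<Sum>j\<in>UNIV. real_of_int (k $ j) * t $ j)))"
  by (simp add: character_def sum_negf)

lemma continuous_on_character [continuous_intros]: "continuous_on S (character k)"
  unfolding character_def cis_conv_exp by (intro continuous_intros)

section \<open>Translation invariance of the integral over a period\<close>

abbreviation unit_cube :: "(real^'d) set" where
  "unit_cube \<equiv> cbox 0 (\<chi> j. 1)"

text \<open>The translated cube is cut at the hyperplane where coordinate j equals 1. The
  overhanging slab, moved back by one period, is exactly the slab of the unit cube below h that the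
  translation vacated.\<close>

lemma integral_unit_cube_translate_axis:
  fixes f :: "real^'d \<Rightarrow> 'b::banach"
  assumes cont: "continuous_on UNIV f" and per: "\<And>t. f (t + axis j 1) = f t"
    and h: "0 \<le> h" "h \<le> 1"
  shows "integral unit_cube (\<lambda>t. f (t + h *\<^sub>R axis j 1)) = integral unit_cube f"
proof -
  define c :: "real^'d" where "c = h *\<^sub>R axis j 1"
  let ?one = "(\<chi> j. 1) :: real^'d"
  have c: "c $ i = (if i = j then h else 0)" for i
    by (simp add: c_def axis_def)
  have int: "f integrable_on cbox a b" for a b
    by (intro integrable_continuous continuous_on_subset[OF cont]) auto
  \<comment> \<open>Isolating coordinate j turns the following equalities of boxes into statements
    about one real variable.\<close>
  have box: "x \<in> cbox a b \<longleftrightarrow> a $ j \<le> x $ j \<and> x $ j \<le> b $ j \<and> (\<forall>i. i \<noteq> j \<longrightarrow> a $ i \<le> x $ i \<and> x $ i \<le> b $ i)"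
    for x a b :: "real^'d"
    by (auto simp: mem_box_cart)
  have axis: "axis j (1::real) $ i = (if i = j then 1 else 0)" for i
    by (simp add: axis_def)
  have bas: "axis j (1::real) \<in> Basis" by (simp add: axis_in_Basis_iff)
  have "integral unit_cube (\<lambda>t. f (t + c)) = integral (cbox c (?one + c)) f"
    using integral_shift_cbox[of c c "?one + c" f] by simp
  also have "\<dots> = integral (cbox c (?one + c) \<inter> {x. x \<bullet> axis j 1 \<le> 1}) f
      + integral (cbox c (?one + c) \<inter> {x. x \<bullet> axis j 1 \<ge> 1}) f"
    by (rule integral_split[OF int bas])
  also have "cbox c (?one + c) \<inter> {x. x \<bullet> axis j 1 \<le> 1} = unit_cube \<inter> {x. x \<bullet> axis j 1 \<ge> h}"
    using h by (auto simp: set_eq_iff box c axis inner_axis)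
  also have "cbox c (?one + c) \<inter> {x. x \<bullet> axis j 1 \<ge> 1} = cbox (axis j 1) ((\<chi> i. if i = j then h else 1) + axis j 1)"
    using h by (auto simp: set_eq_iff box c axis inner_axis)
  also have "integral \<dots> f = integral (cbox 0 (\<chi> i. if i = j then h else 1)) (\<lambda>x. f (x + axis j 1))"
    using integral_shift_cbox[of "axis j 1" "axis j 1" "(\<chi> i. if i = j then h else 1) + axis j 1" f] by simp
  also have "\<dots> = integral (cbox 0 (\<chi> i. if i = j then h else 1)) f"
    by (simp add: per)
  also have "cbox 0 (\<chi> i. if i = j then h else 1) = unit_cube \<inter> {x. x \<bullet> axis j 1 \<le> h}"
    using h by (auto simp: set_eq_iff box c axis inner_axis)
  also have "integral (unit_cube \<inter> {x. x \<bullet> axis j 1 \<ge> h}) f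
      + integral (unit_cube \<inter> {x. x \<bullet> axis j 1 \<le> h}) f = integral unit_cube f"
    by (subst integral_split[OF int bas, of _ _ h]) simp
  finally show ?thesis by (simp add: c_def)
qed

text \<open>Periodicity removes the integer parts of s; the fractional parts lie in [0, 1) and are
  then handled one axis at a time.\<close>

lemma integral_unit_cube_translate:
  fixes f :: "real^'d \<Rightarrow> 'b::banach"
  assumes cont: "continuous_on UNIV f" and per: "\<And>t j. f (t + axis j 1) = f t"
  shows "integral unit_cube (\<lambda>t. f (t + s)) = integral unit_cube f"
proof -
  have per_int: "f (t + real_of_int n *\<^sub>R axis j 1) = f t" for t n j
  proof (induction n rule: int_induct[where k = 0])
    case (step1 i)
    then show ?case using per[of "t + real_of_int i *\<^sub>R axis j 1" j] by (simp add: algebra_simps)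
  next
    case (step2 i)
    then show ?case using per[of "t + real_of_int (i - 1) *\<^sub>R axis j 1" j] by (simp add: algebra_simps)
  qed simp
  have shift: "f (t + s) = f (t + (\<Sum>j\<in>UNIV. frac (s $ j) *\<^sub>R axis j 1))" for t
  proof -
    have "f (t + (\<Sum>j\<in>UNIV. frac (s $ j) *\<^sub>R axis j 1) + (\<Sum>j\<in>J. real_of_int \<lfloor>s $ j\<rfloor> *\<^sub>R axis j 1))
        = f (t + (\<Sum>j\<in>UNIV. frac (s $ j) *\<^sub>R axis j 1))" if "finite J" for J
      using that
    proof induction
      case (insert j J)
      then show ?case
        using per_int[of "t + (\<Sum>j\<in>UNIV. frac (s $ j) *\<^sub>R axis j 1) + (\<Sum>j\<in>J. real_of_int \<lfloor>s $ j\<rfloor> *\<^sub>R axis j 1)" "\<lfloor>s $ j\<rfloor>" j]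
        by (simp add: algebra_simps)
    qed simp
    from this[of UNIV] show ?thesis
      using basis_expansion[of s]
      by (simp add: add.assoc frac_def scalar_mult_eq_scaleR flip: sum.distrib scaleR_add_left)
  qed
  have "integral unit_cube (\<lambda>t. f (t + (\<Sum>j\<in>J. frac (s $ j) *\<^sub>R axis j 1))) = integral unit_cube f"
    if "finite J" for J
    using that
  proof induction
    case (insert j J)
    let ?g = "\<lambda>t. f (t + (\<Sum>j\<in>J. frac (s $ j) *\<^sub>R axis j 1))"
    have "integral unit_cube (\<lambda>t. ?g (t + frac (s $ j) *\<^sub>R axis j 1)) = integral unit_cube ?g"
    proof (rule integral_unit_cube_translate_axis)
      show "continuous_on UNIV ?g"
        by (intro continuous_on_compose2[OF cont] continuous_intros) auto
      show "?g (t + axis j 1) = ?g t" for t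
        using per[of "t + (\<Sum>j\<in>J. frac (s $ j) *\<^sub>R axis j 1)" j] by (simp add: algebra_simps)
    qed (simp_all add: frac_lt_1 less_imp_le)
    with insert show ?case by (simp add: algebra_simps)
  qed simp
  then show ?thesis by (simp add: shift)
qed

section \<open>Fourier coefficients of continuous elements\<close>

lemma content_unit_cube: "measure lborel (unit_cube :: (real^'d) set) = 1"
  by (subst content_cbox_cart) (auto simp: interval_ne_empty_cart)

lemma character_separates:
  fixes k l :: "int^'d"
  assumes "k \<noteq> l"
  obtains s where "character k s \<noteq> character l s"
proof -
  obtain j where j: "k $ j \<noteq> l $ j" using assms by (auto simp: vec_eq_iff)
  \<comment> \<open>Half a period of the character of k - l along axis j, so that its value at this
    point is cis pi = -1.\<close>
  define h where "h = 1 / (2 * real_of_int (k $ j - l $ j))"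
  have "character (k - l) (h *\<^sub>R axis j 1) = - 1"
  proof -
    have "2 * pi * real_of_int ((k - l) $ j) * h = pi"
      using j by (simp add: h_def divide_simps)
    then show ?thesis unfolding character_scaled_axis by (simp only: cis_pi)
  qed
  moreover have "character k s = character (k - l) s * character l s" for s
    by (simp flip: character_add_index)
  ultimately have "character k (h *\<^sub>R axis j 1) = - character l (h *\<^sub>R axis j 1)" by simp
  moreover have "character l (h *\<^sub>R axis j 1) \<noteq> 0"
    by (metis norm_character norm_zero zero_neq_one)
  ultimately show thesis using that[of "h *\<^sub>R axis j 1"] by simp
qed

locale periodic_automorphism_group =
  fixes \<psi> :: "real^'d::{finite,linorder} \<Rightarrow> 'a::complex_banach_algebra_1 \<Rightarrow> 'a"
  assumes group: "automorphism_group \<psi>" and periodic: "periodic_group \<psi>"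
begin

definition action_bound :: real where
  "action_bound = (SUP t. onorm (\<psi> t))"

text \<open>Zero is allowed, so every Fourier coefficient qualifies and a family of eigenvectors may
  be truncated by zeros.\<close>

definition eigenvector :: "int^'d::{finite,linorder} \<Rightarrow> 'a \<Rightarrow> bool" where
  "eigenvector k b \<longleftrightarrow> (\<forall>t. \<psi> t b = scaleC (character k t) b)"

lemma bounded_linear_action: "bounded_linear (\<psi> t)"
  and action_scaleC: "\<psi> t (scaleC c a) = scaleC c (\<psi> t a)"
  and inj_action: "inj (\<psi> t)"
  using group by (auto simp: automorphism_group_def banach_algebra_automorphism_def bij_def)

lemma action_add_time: "\<psi> (s + t) a = \<psi> s (\<psi> t a)"
  using group by (auto simp: automorphism_group_def fun_eq_iff)

lemmas action_add = linear_add[OF bounded_linear.linear[OF bounded_linear_action]]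
  and action_diff = linear_diff[OF bounded_linear.linear[OF bounded_linear_action]]

text \<open>The group law makes \<open>\<psi> 0\<close> idempotent, and injectivity cancels one
  factor.\<close>

lemma action_zero_time [simp]: "\<psi> 0 a = a"
  using action_add_time[of 0 0 a] inj_action[of 0] by (simp add: inj_eq)

lemma action_periodic: "\<psi> (t + axis j 1) = \<psi> t"
  using periodic by (simp add: periodic_group_def)

lemma norm_action_le: "norm (\<psi> t a) \<le> action_bound * norm a"
proof -
  have "norm (\<psi> t a) \<le> onorm (\<psi> t) * norm a"
    by (rule onorm[OF bounded_linear_action])
  also have "\<dots> \<le> action_bound * norm a"
    using group unfolding action_bound_def automorphism_group_def
    by (intro mult_right_mono cSUP_upper) auto
  finally show ?thesis .
qed

lemma action_bound_nonneg: "0 \<le> action_bound"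
proof -
  have "norm (1::'a) \<le> action_bound * norm (1::'a)"
    using norm_action_le[of 0 1] by simp
  from order_trans[OF norm_ge_zero this] show ?thesis
    by (simp add: zero_le_mult_iff)
qed

text \<open>Continuity at 0 is carried to any t by the bounded operator \<open>\<psi> t\<close>,
  since the orbit at t + h is \<open>\<psi> t\<close> applied to the orbit at h.\<close>

lemma continuous_on_action:
  assumes "a \<in> continuous_elements \<psi>"
  shows "continuous_on UNIV (\<lambda>t. \<psi> t a)"
proof -
  have lim: "((\<lambda>h. \<psi> h a) \<longlongrightarrow> a) (at 0)"
    using assms by (simp add: continuous_elements_def)
  have "((\<lambda>h. \<psi> (t + h) a) \<longlongrightarrow> \<psi> t a) (at 0)" for t
    using bounded_linear.tendsto[OF bounded_linear_action lim, of t] by (simp add: action_add_time)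
  then have "isCont (\<lambda>t. \<psi> t a) t" for t
    by (simp add: isCont_iff)
  then show ?thesis
    by (simp add: continuous_at_imp_continuous_on)
qed

lemma continuous_elements_add:
  "a \<in> continuous_elements \<psi> \<Longrightarrow> b \<in> continuous_elements \<psi> \<Longrightarrow> a + b \<in> continuous_elements \<psi>"
  unfolding continuous_elements_def by (simp add: action_add tendsto_add)

lemma continuous_elements_diff:
  "a \<in> continuous_elements \<psi> \<Longrightarrow> b \<in> continuous_elements \<psi> \<Longrightarrow> a - b \<in> continuous_elements \<psi>"
  unfolding continuous_elements_def by (simp add: action_diff tendsto_diff)

lemma continuous_elements_scaleC:
  "a \<in> continuous_elements \<psi> \<Longrightarrow> scaleC c a \<in> continuous_elements \<psi>"
  unfolding continuous_elements_def
  by (simp add: action_scaleC tendsto_scaleC)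

lemma continuous_elements_zero: "0 \<in> continuous_elements \<psi>"
  using linear_0[OF bounded_linear.linear[OF bounded_linear_action]] by (simp add: continuous_elements_def)

lemma continuous_elements_sum:
  "(\<And>i. i \<in> I \<Longrightarrow> f i \<in> continuous_elements \<psi>) \<Longrightarrow> sum f I \<in> continuous_elements \<psi>"
  by (induction I rule: infinite_finite_induct) (auto intro: continuous_elements_add continuous_elements_zero)

lemma continuous_elements_action:
  assumes "a \<in> continuous_elements \<psi>"
  shows "\<psi> s a \<in> continuous_elements \<psi>"
proof -
  have "((\<lambda>h. \<psi> h a) \<longlongrightarrow> a) (at 0)"
    using assms by (simp add: continuous_elements_def)
  from bounded_linear.tendsto[OF bounded_linear_action this, of s] show ?thesis
    by (simp add: continuous_elements_def add.commute flip: action_add_time)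
qed

text \<open>The uniform bound on the group makes norm convergence of elements into uniform
  convergence of their orbit maps, and uniform limits of continuous maps are continuous.\<close>

lemma closed_continuous_elements: "closed (continuous_elements \<psi>)"
  unfolding closed_sequential_limits
proof (intro allI impI, elim conjE)
  fix x and a assume x: "\<forall>n. x n \<in> continuous_elements \<psi>" and lim: "x \<longlonglongrightarrow> a"
  have "uniform_limit UNIV (\<lambda>n t. \<psi> t (x n)) (\<lambda>t. \<psi> t a) sequentially"
    unfolding uniform_limit_iff
  proof (intro allI impI)
    fix e :: real assume "e > 0"
    have "(\<lambda>n. action_bound * dist (x n) a) \<longlonglongrightarrow> action_bound * dist a a"
      by (intro tendsto_intros lim)
    then have "\<forall>\<^sub>F n in sequentially. action_bound * dist (x n) a < e"
      using \<open>e > 0\<close> by (intro order_tendstoD) auto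
    then show "\<forall>\<^sub>F n in sequentially. \<forall>t\<in>UNIV. dist (\<psi> t (x n)) (\<psi> t a) < e"
      by eventually_elim
        (auto simp: dist_norm intro: le_less_trans[OF norm_action_le] simp flip: action_diff)
  qed
  then have "continuous_on UNIV (\<lambda>t. \<psi> t a)"
    by (rule uniform_limit_theorem[rotated]) (auto simp: x continuous_on_action)
  then have "((\<lambda>t. \<psi> t a) \<longlongrightarrow> \<psi> 0 a) (at 0)"
    unfolding continuous_on_def by (metis UNIV_I)
  then show "a \<in> continuous_elements \<psi>" by (simp add: continuous_elements_def)
qed

section \<open>Fourier coefficients as bounded functionals and eigenvectors\<close>

lemma fourier_coeff_character:
  "fourier_coeff \<psi> a k = integral unit_cube (\<lambda>t. scaleC (character (- k) t) (\<psi> t a))"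
  by (simp add: fourier_coeff_def character_uminus)

lemma integrable_action:
  assumes "a \<in> continuous_elements \<psi>" "continuous_on UNIV P"
  shows "(\<lambda>t. scaleC (P t) (\<psi> t a)) integrable_on cbox u v"
  by (intro integrable_continuous continuous_intros continuous_on_subset[OF assms(2)]
      continuous_on_subset[OF continuous_on_action[OF assms(1)]]) auto

lemma fourier_coeff_add:
  "a \<in> continuous_elements \<psi> \<Longrightarrow> b \<in> continuous_elements \<psi> \<Longrightarrow>
    fourier_coeff \<psi> (a + b) k = fourier_coeff \<psi> a k + fourier_coeff \<psi> b k"
  unfolding fourier_coeff_character
  by (simp add: action_add scaleC_add_right integral_add integrable_action continuous_on_character)

lemma fourier_coeff_scaleC:
  assumes "a \<in> continuous_elements \<psi>"
  shows "fourier_coeff \<psi> (scaleC c a) k = scaleC c (fourier_coeff \<psi> a k)"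
proof -
  have "integral unit_cube (scaleC c \<circ> (\<lambda>t. scaleC (character (- k) t) (\<psi> t a))) = scaleC c (fourier_coeff \<psi> a k)"
    unfolding fourier_coeff_character
    by (intro integral_linear integrable_action assms continuous_on_character bounded_linear_scaleC_right)
  then show ?thesis
    by (simp add: fourier_coeff_character comp_def action_scaleC scaleC_scaleC mult.commute)
qed

lemma fourier_coeff_diff:
  assumes "a \<in> continuous_elements \<psi>" "b \<in> continuous_elements \<psi>"
  shows "fourier_coeff \<psi> (a - b) k = fourier_coeff \<psi> a k - fourier_coeff \<psi> b k"
  using fourier_coeff_add[OF continuous_elements_diff[OF assms] assms(2)] by (simp add: algebra_simps)

lemma fourier_coeff_zero: "fourier_coeff \<psi> 0 k = 0"
  using fourier_coeff_diff[OF continuous_elements_zero continuous_elements_zero] by simp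

lemma fourier_coeff_sum:
  assumes "\<And>i. i \<in> I \<Longrightarrow> f i \<in> continuous_elements \<psi>"
  shows "fourier_coeff \<psi> (sum f I) k = (\<Sum>i\<in>I. fourier_coeff \<psi> (f i) k)"
  using assms
  by (induction I rule: infinite_finite_induct)
    (auto simp: fourier_coeff_zero fourier_coeff_add continuous_elements_sum)

lemma norm_fourier_coeff_le:
  assumes "a \<in> continuous_elements \<psi>"
  shows "norm (fourier_coeff \<psi> a k) \<le> action_bound * norm a"
proof -
  have "norm (fourier_coeff \<psi> a k) \<le> integral unit_cube (\<lambda>t::real^'d::{finite,linorder}. action_bound * norm a)"
    unfolding fourier_coeff_character
    by (intro integral_norm_bound_integral integrable_action assms continuous_on_character)
      (auto simp: norm_scaleC norm_action_le)
  then show ?thesis by (simp add: content_unit_cube)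
qed

text \<open>Translate the integration variable by s: the integrand is periodic, and the conjugate
  character contributes the constant factor \<open>character (- k) s\<close>, which is then moved to
  the other side.\<close>

lemma fourier_coeff_action:
  assumes "a \<in> continuous_elements \<psi>"
  shows "fourier_coeff \<psi> (\<psi> s a) k = scaleC (character k s) (fourier_coeff \<psi> a k)"
proof -
  let ?f = "\<lambda>t. scaleC (character (- k) t) (\<psi> t a)"
  have "fourier_coeff \<psi> a k = integral unit_cube (\<lambda>t. ?f (t + s))"
    unfolding fourier_coeff_character
    by (rule integral_unit_cube_translate[symmetric])
      (auto simp: character_add action_periodic intro!: continuous_intros continuous_on_action assms)
  also have "(\<lambda>t. ?f (t + s)) = scaleC (character (- k) s) \<circ> (\<lambda>t. scaleC (character (- k) t) (\<psi> t (\<psi> s a)))"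
    by (auto simp: character_add action_add_time scaleC_scaleC mult.commute)
  also have "integral unit_cube \<dots> = scaleC (character (- k) s) (fourier_coeff \<psi> (\<psi> s a) k)"
    unfolding fourier_coeff_character
    by (intro integral_linear integrable_action continuous_elements_action assms continuous_on_character
        bounded_linear_scaleC_right)
  finally show ?thesis
    using character_add_index[of k "- k" s] by (simp add: scaleC_scaleC)
qed

text \<open>A bounded operator passes through the integral, and \<psi>_s \<psi>_t = \<psi>_t
  \<psi>_s turns the result into the coefficient of \<open>\<psi> s a\<close>.\<close>

lemma eigenvector_fourier_coeff:
  assumes "a \<in> continuous_elements \<psi>"
  shows "eigenvector k (fourier_coeff \<psi> a k)"
  unfolding eigenvector_def
proof
  fix s
  have "\<psi> s (fourier_coeff \<psi> a k) = integral unit_cube (\<psi> s \<circ> (\<lambda>t. scaleC (character (- k) t) (\<psi> t a)))"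
    unfolding fourier_coeff_character
    by (intro integral_linear[symmetric] integrable_action assms continuous_on_character bounded_linear_action)
  also have "\<dots> = fourier_coeff \<psi> (\<psi> s a) k"
    unfolding fourier_coeff_character
    by (simp add: comp_def action_scaleC add.commute flip: action_add_time)
  finally show "\<psi> s (fourier_coeff \<psi> a k) = scaleC (character k s) (fourier_coeff \<psi> a k)"
    by (simp add: fourier_coeff_action assms)
qed

lemma eigenvector_imp_continuous:
  assumes "eigenvector k b"
  shows "b \<in> continuous_elements \<psi>"
proof -
  have "((\<lambda>t. scaleC (character k t) b) \<longlongrightarrow> scaleC (character k 0) b) (at 0)"
    using continuous_on_character[of UNIV k] unfolding continuous_on_def
    by (intro tendsto_intros) (metis UNIV_I)
  with assms show ?thesis by (simp add: eigenvector_def continuous_elements_def)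
qed

text \<open>Orthogonality without integrating characters: for k \<noteq> l the coefficient of
  \<open>\<psi> s b\<close> acquires the factor \<open>character k s\<close> by covariance and
  \<open>character l s\<close> by linearity. Choosing s where they differ forces it to
  vanish.\<close>

lemma fourier_coeff_eigenvector:
  assumes b: "eigenvector l b"
  shows "fourier_coeff \<psi> b k = (if k = l then b else 0)"
proof (cases "k = l")
  case True
  have "fourier_coeff \<psi> b l = integral unit_cube (\<lambda>t::real^'d::{finite,linorder}. b)"
    using b by (simp add: fourier_coeff_character eigenvector_def scaleC_scaleC flip: character_add_index)
  with True show ?thesis by (simp add: content_unit_cube)
next
  case False
  then obtain s where s: "character k s \<noteq> character l s" by (rule character_separates)
  have cb: "b \<in> continuous_elements \<psi>" by (rule eigenvector_imp_continuous[OF b])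
  have "scaleC (character k s) (fourier_coeff \<psi> b k) = fourier_coeff \<psi> (scaleC (character l s) b) k"
    using fourier_coeff_action[OF cb, of s k] b by (simp add: eigenvector_def)
  also have "\<dots> = scaleC (character l s) (fourier_coeff \<psi> b k)"
    by (rule fourier_coeff_scaleC[OF cb])
  finally have "scaleC (character k s - character l s) (fourier_coeff \<psi> b k) = 0"
    using scaleC_add_left[of "character k s - character l s" "character l s" "fourier_coeff \<psi> b k"] by simp
  then have "cmod (character k s - character l s) * norm (fourier_coeff \<psi> b k) = 0"
    by (simp flip: norm_scaleC)
  with s False show ?thesis by simp
qed

end

section \<open>Uniqueness of Fourier coefficients\<close>

text \<open>If c > 0, split the right-hand integral at G = c/2. Where G < c/2, half of the left side
  absorbs the integrand. Where G \<ge> c/2, compactness gives \<phi> \<le> q < 1, so that part is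
  O(q^n). But \<phi> is close to 1 near 0, so its n-th power has integral at least v q'^n with q' >
  q, a contradiction for large n. \<phi> may equal 1 at further points, provided G is not positive
  there.\<close>

lemma concentrating_kernel:
  fixes \<phi> G :: "real^'d \<Rightarrow> real"
  assumes \<phi>: "continuous_on unit_cube \<phi>" "\<And>t. t \<in> unit_cube \<Longrightarrow> 0 \<le> \<phi> t" "\<phi> 0 = 1"
    and G: "continuous_on unit_cube G"
    and peak: "\<And>t. t \<in> unit_cube \<Longrightarrow> 0 < G t \<Longrightarrow> \<phi> t < 1"
    and le: "\<And>n. c * integral unit_cube (\<lambda>t. \<phi> t ^ n) \<le> integral unit_cube (\<lambda>t. \<phi> t ^ n * G t)"
  shows "c \<le> 0"
proof (rule ccontr)
  assume "\<not> c \<le> 0"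
  then have c: "c > 0" by simp
  have cmp: "compact (unit_cube :: (real^'d) set)" and ne: "(unit_cube :: (real^'d) set) \<noteq> {}"
    by (auto simp: interval_ne_empty_cart)
  define S where "S = {t \<in> unit_cube. c / 2 \<le> G t}"
  have "closed S"
    unfolding S_def by (intro continuous_closed_preimage_constant continuous_on_closed_Collect_le
        continuous_intros G closed_cbox)
  then have cS: "compact S"
    using compact_Int_closed[OF cmp, of S] by (simp add: S_def Int_absorb1 Collect_conj_eq)
  have "\<exists>q\<ge>0. q < 1 \<and> (\<forall>t\<in>S. \<phi> t \<le> q)"
  proof (cases "S = {}")
    case False
    have "continuous_on S \<phi>"
      by (rule continuous_on_subset[OF \<phi>(1)]) (auto simp: S_def)
    then obtain s where s: "s \<in> S" "\<And>t. t \<in> S \<Longrightarrow> \<phi> t \<le> \<phi> s"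
      using continuous_attains_sup[OF cS False] by blast
    then show ?thesis
      using c peak[of s] \<phi>(2)[of s] by (intro exI[of _ "\<phi> s"]) (auto simp: S_def)
  qed auto
  then obtain q where q: "0 \<le> q" "q < 1" "\<And>t. t \<in> S \<Longrightarrow> \<phi> t \<le> q" by blast
  obtain L where L: "\<And>t. t \<in> unit_cube \<Longrightarrow> G t \<le> L"
    using continuous_attains_sup[OF cmp ne G] by blast
  \<comment> \<open>The maximum with 0 keeps the error term nonnegative even if G is negative
    throughout.\<close>
  define L' where "L' = max L 0"
  obtain q' where q': "q < q'" "q' < 1" using dense q(2) by blast
  have "0 < q'" using q q' by simp
  have z: "0 \<in> (unit_cube :: (real^'d) set)" by (simp add: mem_box_cart)
  obtain \<delta> where \<delta>: "\<delta> > 0" "\<And>t. t \<in> unit_cube \<Longrightarrow> dist t 0 < \<delta> \<Longrightarrow> dist (\<phi> t) (\<phi> 0) < 1 - q'"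
    using \<phi>(1) z q'(2) unfolding continuous_on_iff by (metis diff_gt_0_iff_gt)
  \<comment> \<open>The norm on Q is at most the sum of the coordinates, hence less than \<delta>:
    the factor 2 makes this strict. The minimum with 1 keeps Q inside the cube.\<close>
  define \<eta> where "\<eta> = min 1 (\<delta> / (2 * real CARD('d)))"
  have \<eta>: "0 < \<eta>" "\<eta> \<le> 1" "real CARD('d) * \<eta> < \<delta>"
    using \<delta>(1) by (auto simp: \<eta>_def min_def field_simps)
  define Q where "Q = cbox 0 ((\<chi> j. \<eta>) :: real^'d)"
  have Qsub: "Q \<subseteq> unit_cube"
    using \<eta>(2) by (auto simp: Q_def mem_box_cart) (meson order_trans)
  have Qlow: "q' \<le> \<phi> t" if "t \<in> Q" for t
  proof -
    have "norm t \<le> (\<Sum>j\<in>UNIV. \<bar>t $ j\<bar>)" by (rule norm_le_l1_cart)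
    also have "\<dots> \<le> (\<Sum>j\<in>(UNIV::'d set). \<eta>)"
      using that by (intro sum_mono) (auto simp: Q_def mem_box_cart)
    finally have "norm t < \<delta>" using \<eta>(3) by simp
    then show ?thesis
      using \<delta>(2)[of t] that Qsub \<phi>(3) by (auto simp: dist_real_def)
  qed
  define v where "v = measure lborel Q"
  have "v > 0"
    unfolding v_def Q_def using \<eta>(1)
    by (subst content_cbox_cart) (auto simp: interval_ne_empty_cart less_imp_le intro!: prod_pos)
  have intp: "(\<lambda>t. \<phi> t ^ n) integrable_on unit_cube" for n
    by (intro integrable_continuous continuous_intros \<phi>(1))
  have bound: "c / 2 * v * q' ^ n \<le> L' * q ^ n" for n
  proof -
    let ?I = "integral unit_cube (\<lambda>t. \<phi> t ^ n)"
    have "v * q' ^ n = integral Q (\<lambda>t. q' ^ n)"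
      by (simp add: v_def Q_def)
    also have "\<dots> \<le> integral Q (\<lambda>t. \<phi> t ^ n)"
      using Qlow \<open>0 < q'\<close> intp[of n] Qsub unfolding Q_def
      by (intro integral_le) (auto intro!: power_mono intro: integrable_on_subcbox)
    also have "\<dots> \<le> ?I"
      using Qsub \<phi>(2) intp[of n] unfolding Q_def
      by (intro integral_subset_le) (auto intro: integrable_on_subcbox)
    finally have low: "v * q' ^ n \<le> ?I" .
    have "c * ?I \<le> integral unit_cube (\<lambda>t. \<phi> t ^ n * G t)" by (rule le)
    also have "\<dots> \<le> integral unit_cube (\<lambda>t. c / 2 * \<phi> t ^ n + L' * q ^ n)"
    proof (intro integral_le)
      show "(\<lambda>t. \<phi> t ^ n * G t) integrable_on unit_cube"
        by (intro integrable_continuous continuous_intros \<phi>(1) G)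
      show "(\<lambda>t. c / 2 * \<phi> t ^ n + L' * q ^ n) integrable_on unit_cube"
        by (intro integrable_continuous continuous_intros \<phi>(1))
      fix t assume t: "t \<in> (unit_cube :: (real^'d) set)"
      show "\<phi> t ^ n * G t \<le> c / 2 * \<phi> t ^ n + L' * q ^ n"
      proof (cases "t \<in> S")
        case True
        have "\<phi> t ^ n * G t \<le> \<phi> t ^ n * L'"
          using L[OF t] \<phi>(2)[OF t] by (intro mult_left_mono) (auto simp: L'_def)
        also have "\<dots> \<le> q ^ n * L'"
          using q(3)[OF True] \<phi>(2)[OF t] by (intro mult_right_mono power_mono) (auto simp: L'_def)
        also have "\<dots> \<le> c / 2 * \<phi> t ^ n + L' * q ^ n"
          using c \<phi>(2)[OF t] by simp
        finally show ?thesis .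
      next
        case False
        then have "\<phi> t ^ n * G t \<le> \<phi> t ^ n * (c / 2)"
          using t \<phi>(2)[OF t] by (intro mult_left_mono) (auto simp: S_def)
        also have "\<dots> \<le> c / 2 * \<phi> t ^ n + L' * q ^ n"
          using q(1) by (simp add: L'_def)
        finally show ?thesis .
      qed
    qed
    also have "\<dots> = c / 2 * ?I + L' * q ^ n"
      by (subst integral_add) (auto simp: content_unit_cube intro!: integrable_continuous continuous_intros \<phi>(1))
    finally have "c / 2 * ?I \<le> L' * q ^ n" by simp
    moreover have "c / 2 * (v * q' ^ n) \<le> c / 2 * ?I"
      using low c by (intro mult_left_mono) auto
    ultimately show ?thesis by simp
  qed
  have "(\<lambda>n. L' * (q / q') ^ n) \<longlonglongrightarrow> L' * 0"
    using q q' \<open>0 < q'\<close> by (intro tendsto_intros LIMSEQ_realpow_zero) auto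
  moreover have "c / 2 * v \<le> L' * (q / q') ^ n" for n
    using bound[of n] \<open>0 < q'\<close> by (simp add: field_simps)
  ultimately have "c / 2 * v \<le> L' * 0"
    by (intro LIMSEQ_le_const) auto
  with c \<open>v > 0\<close> show False by (simp add: mult_le_0_iff)
qed

lemma character_axis_index: "character (axis j 1) t = cis (2 * pi * t $ j)"
proof -
  have "(\<Sum>i\<in>UNIV. real_of_int (axis j 1 $ i) * t $ i) = t $ j"
    by (subst sum.remove[of _ j]) (auto simp: axis_def intro!: sum.neutral)
  then show ?thesis by (simp add: character_def)
qed

lemma cos_character:
  "complex_of_real (cos (2 * pi * t $ j)) = (character (axis j 1) t + character (- axis j 1) t) / 2"
proof -
  have "character (- axis j 1) t = cnj (character (axis j 1) t)"
    by (simp add: character_def sum_negf cis_cnj)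
  then show ?thesis
    by (simp add: character_axis_index complex_eq_iff)
qed

context periodic_automorphism_group
begin

text \<open>Multiplication by the kernel factors \<open>(1 + cos(2\<pi>t\<^sub>j)) / 2\<close> only shifts the frequency
  \<open>k\<close>, so quantifying over all \<open>k\<close> makes this set closed under it.\<close>
definition annihilator :: "'a \<Rightarrow> (real^'d::{finite,linorder} \<Rightarrow> complex) set" where
  "annihilator a = {P. continuous_on UNIV P \<and>
     (\<forall>k. ((\<lambda>t. scaleC (P t * character k t) (\<psi> t a)) has_integral 0) unit_cube)}"

lemma annihilator_cos:
  assumes P: "P \<in> annihilator a"
  shows "(\<lambda>t. P t * of_real ((1 + cos (2 * pi * t $ j)) / 2)) \<in> annihilator a"
  unfolding annihilator_def mem_Collect_eq
proof (intro conjI allI)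
  show "continuous_on UNIV (\<lambda>t. P t * of_real ((1 + cos (2 * pi * t $ j)) / 2))"
    using P by (auto simp: annihilator_def intro!: continuous_intros)
  fix k
  let ?f = "\<lambda>k t. scaleC (P t * character k t) (\<psi> t a)"
  have I: "(?f k has_integral 0) unit_cube" for k
    using P by (simp add: annihilator_def)
  have J: "((\<lambda>t. scaleC c (?f k t)) has_integral 0) unit_cube" for c k
    using has_integral_linear[OF I bounded_linear_scaleC_right, of c k]
    by (simp add: comp_def linear_0[OF bounded_linear.linear[OF bounded_linear_scaleC_right]])
  \<comment> \<open>The weights come from (1 + cos) / 2 = 1/2 + 1/4 e_j-character + 1/4
    (-e_j)-character.\<close>
  have "((\<lambda>t. scaleC (1/2) (?f k t) + (scaleC (1/4) (?f (k + axis j 1) t) + scaleC (1/4) (?f (k + - axis j 1) t)))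
      has_integral (0 + (0 + 0))) unit_cube"
    by (intro has_integral_add J)
  moreover have "scaleC (P t * of_real ((1 + cos (2 * pi * t $ j)) / 2) * character k t) (\<psi> t a)
      = scaleC (1/2) (?f k t) + (scaleC (1/4) (?f (k + axis j 1) t) + scaleC (1/4) (?f (k + - axis j 1) t))" for t
    unfolding scaleC_scaleC character_add_index
    by (simp only: of_real_divide of_real_add cos_character of_real_1 of_real_numeral
        flip: scaleC_add_left) (simp add: field_simps)
  ultimately show "((\<lambda>t. scaleC (P t * of_real ((1 + cos (2 * pi * t $ j)) / 2) * character k t) (\<psi> t a))
      has_integral 0) unit_cube"
    by simp
qed

lemma annihilator_kernel:
  assumes "(\<lambda>t. 1) \<in> annihilator a"
  shows "(\<lambda>t. complex_of_real ((\<Prod>j\<in>UNIV. (1 + cos (2 * pi * t $ j)) / 2) ^ n)) \<in> annihilator a"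
proof (induction n)
  case (Suc n)
  \<comment> \<open>The next power of the kernel is assembled factor by factor, over a growing set J
    of coordinates, since \<open>annihilator_cos\<close> supplies a single one.\<close>
  have "(\<lambda>t. complex_of_real ((\<Prod>j\<in>UNIV. (1 + cos (2 * pi * t $ j)) / 2) ^ n) *
      of_real (\<Prod>j\<in>J. (1 + cos (2 * pi * t $ j)) / 2)) \<in> annihilator a" if "finite J" for J
    using that
  proof induction
    case (insert j J)
    from annihilator_cos[OF this(3), of j] insert(1,2) show ?case
      by (simp only: prod.insert[OF insert(1,2)] of_real_mult ac_simps)
  qed (use Suc in simp)
  from this[of UNIV] show ?case by (simp add: mult.commute)
qed (use assms in simp)

text \<open>The kernel powers integrate the orbit of a to 0, so against the orbit minus a they give
  -(integral of \<phi>^n) a. Hence \<open>norm a\<close> times the integral of \<phi>^n is at most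
  the integral of \<phi>^n against \<open>norm (\<psi> t a - a)\<close>, a function that vanishes
  wherever \<phi> = 1.\<close>

lemma fourier_coeff_eq_zero_imp_zero:
  assumes a: "a \<in> continuous_elements \<psi>" and zero: "\<And>k. fourier_coeff \<psi> a k = 0"
  shows "a = 0"
proof -
  define \<phi> :: "real^'d::{finite,linorder} \<Rightarrow> real" where "\<phi> t = (\<Prod>j\<in>UNIV. (1 + cos (2 * pi * t $ j)) / 2)" for t
  have range: "0 \<le> (1 + y) / 2 \<and> (1 + y) / 2 \<le> 1" if "- 1 \<le> y" "y \<le> 1" for y :: real
    using that by simp
  have f01: "0 \<le> (1 + cos (2 * pi * x)) / 2" "(1 + cos (2 * pi * x)) / 2 \<le> 1" for x
    using range[OF cos_ge_minus_one cos_le_one] by blast+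
  have f0: "0 \<le> 1 + cos y" for y :: real
    using range[OF cos_ge_minus_one cos_le_one, of y] by simp
  have cont\<phi>: "continuous_on S \<phi>" for S
    unfolding \<phi>_def by (intro continuous_intros) auto
  have conta: "continuous_on S (\<lambda>t. \<psi> t a)" for S
    by (rule continuous_on_subset[OF continuous_on_action[OF a]]) auto
  have one: "(\<lambda>t. 1) \<in> annihilator a"
    unfolding annihilator_def mem_Collect_eq
  proof (intro conjI allI)
    fix k
    have "integral unit_cube (\<lambda>t. scaleC (character k t) (\<psi> t a)) = 0"
      using zero[of "- k"] by (simp add: fourier_coeff_character)
    then show "((\<lambda>t. scaleC (1 * character k t) (\<psi> t a)) has_integral 0) unit_cube"
      using integrable_action[OF a continuous_on_character, of k] by (simp add: has_integral_iff)
  qed auto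
  have ann: "((\<lambda>t. \<phi> t ^ n *\<^sub>R \<psi> t a) has_integral 0) unit_cube" for n
  proof -
    have "((\<lambda>t. scaleC (complex_of_real (\<phi> t ^ n) * character 0 t) (\<psi> t a)) has_integral 0) unit_cube"
      using annihilator_kernel[OF one, of n] unfolding annihilator_def \<phi>_def by blast
    then show ?thesis by (simp only: character_zero_index mult_1_right scaleC_of_real)
  qed
  have \<phi>0: "0 \<le> \<phi> t" for t
    unfolding \<phi>_def by (intro prod_nonneg) (auto simp: f0)
  have "norm a \<le> 0"
  proof (rule concentrating_kernel[of \<phi> "\<lambda>t. norm (\<psi> t a - a)"])
    show "continuous_on unit_cube (\<lambda>t. norm (\<psi> t a - a))"
      by (intro continuous_intros conta)
    show "0 \<le> \<phi> t" for t by (rule \<phi>0)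
    show "\<phi> 0 = 1" by (simp add: \<phi>_def)
    show "\<phi> t < 1" if t: "t \<in> unit_cube" and pos: "0 < norm (\<psi> t a - a)" for t
    proof (rule ccontr)
      assume "\<not> \<phi> t < 1"
      \<comment> \<open>All factors lie in [0, 1], so a product not below 1 forces every cosine to
        be 1. In the cube only the corners remain, and there periodicity gives
        \<open>\<psi> t a = a\<close>.\<close>
      have one: "cos (2 * pi * t $ j) = 1" for j
      proof -
        have "\<phi> t = (1 + cos (2 * pi * t $ j)) / 2 * (\<Prod>j\<in>UNIV - {j}. (1 + cos (2 * pi * t $ j)) / 2)"
          unfolding \<phi>_def by (subst prod.remove[of _ j]) auto
        also have "\<dots> \<le> (1 + cos (2 * pi * t $ j)) / 2 * 1"
          by (intro mult_left_mono prod_le_1) (auto simp: f0)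
        finally show ?thesis
          using \<open>\<not> \<phi> t < 1\<close> by - (rule antisym, rule cos_le_one, simp)
      qed
      have t01: "t $ j = 0 \<or> t $ j = 1" for j
      proof -
        obtain m :: int where m: "t $ j = of_int m"
          using one[of j] unfolding cos_one_2pi_int by auto
        with t show ?thesis by (auto simp: mem_box_cart)
          (metis m of_int_0_le_iff of_int_le_1_iff of_int_0 of_int_1 le_less zless_imp_add1_zle add_0 dual_order.antisym)
      qed
      have "\<psi> (\<Sum>j\<in>J. (t $ j) *\<^sub>R axis j 1) a = a" if "finite J" for J
        using that
      proof induction
        case (insert j J)
        then show ?case
          using t01[of j] action_periodic[of "\<Sum>j\<in>J. (t $ j) *\<^sub>R axis j 1" j] by (auto simp: add.commute)
      qed simp
      from this[of UNIV] have "\<psi> t a = a"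
        using basis_expansion[of t] by (simp add: scalar_mult_eq_scaleR)
      with pos show False by simp
    qed
    show "norm a * integral unit_cube (\<lambda>t. \<phi> t ^ n)
        \<le> integral unit_cube (\<lambda>t. \<phi> t ^ n * norm (\<psi> t a - a))" for n
    proof -
      have intp: "(\<lambda>t. \<phi> t ^ n) integrable_on unit_cube"
        by (intro integrable_continuous continuous_intros cont\<phi>)
      have I0: "0 \<le> integral unit_cube (\<lambda>t. \<phi> t ^ n)"
        by (intro integral_nonneg intp) (simp add: \<phi>0)
      have "((\<lambda>t. \<phi> t ^ n *\<^sub>R a) has_integral integral unit_cube (\<lambda>t. \<phi> t ^ n) *\<^sub>R a) unit_cube"
        using has_integral_linear[OF integrable_integral[OF intp] bounded_linear_scaleR_left[of a]]
        by (simp add: comp_def)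
      from has_integral_diff[OF ann[of n] this]
      have "((\<lambda>t. \<phi> t ^ n *\<^sub>R (\<psi> t a - a)) has_integral - (integral unit_cube (\<lambda>t. \<phi> t ^ n) *\<^sub>R a)) unit_cube"
        by (simp add: scaleR_diff_right)
      then have "norm (integral unit_cube (\<lambda>t. \<phi> t ^ n) *\<^sub>R a) = norm (integral unit_cube (\<lambda>t. \<phi> t ^ n *\<^sub>R (\<psi> t a - a)))"
        by (simp add: integral_unique)
      also have "\<dots> \<le> integral unit_cube (\<lambda>t. \<phi> t ^ n * norm (\<psi> t a - a))"
        by (intro integral_norm_bound_integral integrable_continuous continuous_intros cont\<phi> conta)
          (simp add: \<phi>0)
      finally show ?thesis using I0 by (simp add: mult.commute)
    qed
  qed (rule cont\<phi>)
  then show ?thesis by simp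
qed

end

section \<open>Generators\<close>

text \<open>First-order Taylor remainder of exp; the argument is imaginary, so the factor exp |Re z|
  in the remainder equals 1.\<close>

lemma norm_cis_Taylor: "cmod (cis x - 1 - \<i> * of_real x) \<le> x\<^sup>2"
  using Taylor_exp[of "\<i> * of_real x" 1]
  by (simp add: cis_conv_exp norm_mult power2_eq_square algebra_simps)

text \<open>Linear in |h| with a constant that grows only quadratically in the frequency: this is
  what lets one bound serve all terms of a rapidly decreasing series.\<close>

lemma norm_cis_quotient:
  assumes "h \<noteq> 0"
  shows "cmod ((cis (\<theta> * h) - 1) / of_real h - \<i> * of_real \<theta>) \<le> \<theta>\<^sup>2 * \<bar>h\<bar>"
proof -
  have "(cis (\<theta> * h) - 1) / of_real h - \<i> * of_real \<theta> = (cis (\<theta> * h) - 1 - \<i> * of_real (\<theta> * h)) / of_real h"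
    using assms by (simp add: field_simps)
  also have "cmod \<dots> \<le> (\<theta> * h)\<^sup>2 / \<bar>h\<bar>"
    using norm_cis_Taylor[of "\<theta> * h"] by (simp add: norm_divide divide_right_mono)
  also have "\<dots> = \<theta>\<^sup>2 * \<bar>h\<bar>"
    using assms by (simp add: power2_eq_square field_simps abs_mult_self_eq flip: abs_mult)
  finally show ?thesis .
qed

lemma tendsto_cis_quotient:
  "((\<lambda>h. (cis (\<theta> * h) - 1) / of_real h) \<longlongrightarrow> \<i> * of_real \<theta>) (at 0)"
proof -
  have "((\<lambda>h. (cis (\<theta> * h) - 1) / of_real h - \<i> * of_real \<theta>) \<longlongrightarrow> 0) (at 0)"
  proof (rule Lim_null_comparison)
    show "\<forall>\<^sub>F h in at 0. norm ((cis (\<theta> * h) - 1) / of_real h - \<i> * of_real \<theta>) \<le> \<theta>\<^sup>2 * \<bar>h\<bar>"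
      unfolding eventually_at by (intro exI[of _ 1]) (auto simp: norm_cis_quotient)
    have "((\<lambda>h. \<theta>\<^sup>2 * \<bar>h\<bar>) \<longlongrightarrow> \<theta>\<^sup>2 * \<bar>0\<bar>) (at (0::real))"
      by (intro tendsto_intros)
    then show "((\<lambda>h. \<theta>\<^sup>2 * \<bar>h\<bar>) \<longlongrightarrow> 0) (at (0::real))" by simp
  qed
  then show ?thesis by (simp add: LIM_zero_iff)
qed

lemma has_sum_diff:
  fixes f g :: "'i \<Rightarrow> 'a::real_normed_vector"
  assumes "(f has_sum a) A" "(g has_sum b) A"
  shows "((\<lambda>i. f i - g i) has_sum (a - b)) A"
  using has_sum_add[OF assms(1) has_sum_scaleR[OF assms(2), of "-1"]] by simp

section \<open>Sup norm on the lattice, symbols of the generators and rapid decrease\<close>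

lemma abs_le_sup_norm_int: "\<bar>real_of_int (k $ j)\<bar> \<le> sup_norm_int k"
  unfolding sup_norm_int_def by (metis Max_ge finite finite_imageI of_int_abs of_int_le_iff rangeI)

lemma sup_norm_int_nonneg: "0 \<le> sup_norm_int k"
  using abs_le_sup_norm_int[of k undefined] by linarith

text \<open>The factor by which the composed generators along w act on k-th eigenvectors; for the
  word of a multi-index \<alpha> it is (2 pi i k)^\<alpha>.\<close>

definition derivative_symbol :: "'d list \<Rightarrow> int^'d \<Rightarrow> complex" where
  "derivative_symbol w k = (\<Prod>j\<leftarrow>w. \<i> * of_real (2 * pi * real_of_int (k $ j)))"

lemma norm_derivative_symbol_le:
  "cmod (derivative_symbol w k) \<le> (2 * pi * sup_norm_int k) ^ length w"
proof (induction w)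
  case (Cons j w)
  have "cmod (\<i> * of_real (2 * pi * real_of_int (k $ j))) \<le> 2 * pi * sup_norm_int k"
    using abs_le_sup_norm_int[of k j] by (simp add: norm_mult)
  then show ?case
    using Cons by (simp add: derivative_symbol_def norm_mult mult_mono sup_norm_int_nonneg)
qed (simp add: derivative_symbol_def)

text \<open>Stable under multiplication by symbols, hence under repeated termwise differentiation.
  It covers both finitely supported families, needed for partial sums, and the coefficients of
  elements of finite C^1-norm.\<close>

definition rapidly_decreasing :: "(int^'d \<Rightarrow> 'a::real_normed_vector) \<Rightarrow> bool" where
  "rapidly_decreasing b \<longleftrightarrow> (\<forall>n. (\<lambda>k. sup_norm_int k ^ n * norm (b k)) summable_on UNIV)"

lemma rapidly_decreasing_symbol:
  fixes b :: "int^'d \<Rightarrow> 'a::complex_banach_algebra_1"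
  assumes "rapidly_decreasing b"
  shows "rapidly_decreasing (\<lambda>k. scaleC (derivative_symbol w k) (b k))"
  unfolding rapidly_decreasing_def
proof
  fix n
  have "(\<lambda>k. (2 * pi) ^ length w * (sup_norm_int k ^ (n + length w) * norm (b k))) summable_on UNIV"
    using assms unfolding rapidly_decreasing_def by (intro summable_on_cmult_right) auto
  then show "(\<lambda>k. sup_norm_int k ^ n * norm (scaleC (derivative_symbol w k) (b k))) summable_on UNIV"
  proof (rule summable_on_comparison_test)
    fix k :: "int^'d"
    have "sup_norm_int k ^ n * (cmod (derivative_symbol w k) * norm (b k))
        \<le> sup_norm_int k ^ n * ((2 * pi * sup_norm_int k) ^ length w * norm (b k))"
      by (intro mult_left_mono mult_right_mono norm_derivative_symbol_le) (auto simp: sup_norm_int_nonneg)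
    then show "sup_norm_int k ^ n * norm (scaleC (derivative_symbol w k) (b k))
        \<le> (2 * pi) ^ length w * (sup_norm_int k ^ (n + length w) * norm (b k))"
      by (simp add: norm_scaleC power_mult_distrib power_add ac_simps)
  qed (simp add: sup_norm_int_nonneg)
qed

lemma rapidly_decreasing_imp_summable:
  fixes b :: "int^'d \<Rightarrow> 'a::banach"
  assumes "rapidly_decreasing b"
  shows "b summable_on UNIV"
proof (rule abs_summable_summable)
  show "(\<lambda>k. norm (b k)) summable_on UNIV"
    using assms unfolding rapidly_decreasing_def by (elim allE[of _ 0]) simp
qed

lemma rapidly_decreasing_finite:
  assumes "finite K" "\<And>k. k \<notin> K \<Longrightarrow> b k = 0"
  shows "rapidly_decreasing b"
  unfolding rapidly_decreasing_def
proof
  fix n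
  have "(\<lambda>k. sup_norm_int k ^ n * norm (b k)) summable_on K"
    using assms(1) by simp
  then show "(\<lambda>k. sup_norm_int k ^ n * norm (b k)) summable_on UNIV"
    by (rule summable_on_cong_neutral[THEN iffD1, rotated -1]) (auto simp: assms(2))
qed

context periodic_automorphism_group
begin

section \<open>Generators, continuity and termwise differentiation\<close>

lemma generatorI:
  assumes "((\<lambda>h::real. (1 / h) *\<^sub>R (\<psi> (h *\<^sub>R axis j 1) a - a)) \<longlongrightarrow> b) (at 0)"
  shows "a \<in> generator_dom \<psi> j" "generator \<psi> j a = b"
  using assms by (auto simp: generator_dom_def generator_def intro!: tendsto_Lim)

lemma tendsto_generator:
  assumes "a \<in> generator_dom \<psi> j"
  shows "((\<lambda>h::real. (1 / h) *\<^sub>R (\<psi> (h *\<^sub>R axis j 1) a - a)) \<longlongrightarrow> generator \<psi> j a) (at 0)"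
  using assms generatorI(2) by (auto simp: generator_dom_def)

lemma generator_diff:
  assumes "a \<in> generator_dom \<psi> j" "b \<in> generator_dom \<psi> j"
  shows "a - b \<in> generator_dom \<psi> j" "generator \<psi> j (a - b) = generator \<psi> j a - generator \<psi> j b"
proof -
  have "((\<lambda>h::real. (1 / h) *\<^sub>R (\<psi> (h *\<^sub>R axis j 1) (a - b) - (a - b)))
      \<longlongrightarrow> generator \<psi> j a - generator \<psi> j b) (at 0)"
    using tendsto_diff[OF tendsto_generator[OF assms(1)] tendsto_generator[OF assms(2)]]
    by (simp add: action_diff algebra_simps)
  then show "a - b \<in> generator_dom \<psi> j" "generator \<psi> j (a - b) = generator \<psi> j a - generator \<psi> j b"
    by (auto dest: generatorI)
qed

lemma generator_word_diff:
  assumes "a \<in> generator_word_dom \<psi> w" "b \<in> generator_word_dom \<psi> w"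
  shows "a - b \<in> generator_word_dom \<psi> w \<and> generator_word \<psi> w (a - b) = generator_word \<psi> w a - generator_word \<psi> w b"
  using assms by (induction w) (auto simp: generator_diff)

lemma smooth_elements_diff:
  assumes "a \<in> smooth_elements \<psi>" "b \<in> smooth_elements \<psi>"
  shows "a - b \<in> smooth_elements \<psi>" "multi_deriv \<psi> \<alpha> (a - b) = multi_deriv \<psi> \<alpha> a - multi_deriv \<psi> \<alpha> b"
  using assms generator_word_diff by (auto simp: smooth_elements_def multi_deriv_dom_def multi_deriv_def)

text \<open>Differentiability along an axis gives continuity along it. The coordinates of t are then
  added one by one; the increment of one coordinate is moved by the remaining part of the group,
  which enlarges it by at most \<open>action_bound\<close>.\<close>

lemma generator_domI_continuous:
  assumes "\<And>j. a \<in> generator_dom \<psi> j"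
  shows "a \<in> continuous_elements \<psi>"
proof -
  have axis: "isCont (\<lambda>h::real. \<psi> (h *\<^sub>R axis j 1) a) 0" for j
  proof -
    have "((\<lambda>h. h *\<^sub>R ((1 / h) *\<^sub>R (\<psi> (h *\<^sub>R axis j 1) a - a))) \<longlongrightarrow> 0 *\<^sub>R generator \<psi> j a) (at 0)"
      by (intro tendsto_scaleR tendsto_ident_at tendsto_generator assms)
    then have "((\<lambda>h. h *\<^sub>R ((1 / h) *\<^sub>R (\<psi> (h *\<^sub>R axis j 1) a - a))) \<longlongrightarrow> 0) (at 0)"
      by simp
    then have "((\<lambda>h. \<psi> (h *\<^sub>R axis j 1) a - a) \<longlongrightarrow> 0) (at 0)"
    proof (rule Lim_transform_eventually)
      show "\<forall>\<^sub>F h in at 0. h *\<^sub>R ((1 / h) *\<^sub>R (\<psi> (h *\<^sub>R axis j 1) a - a)) = \<psi> (h *\<^sub>R axis j 1) a - a"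
        unfolding eventually_at by (intro exI[of _ 1]) simp
    qed
    then show ?thesis by (simp add: isCont_def LIM_zero_iff)
  qed
  have "((\<lambda>t. \<psi> (\<Sum>j\<in>J. (t $ j) *\<^sub>R axis j 1) a - a) \<longlongrightarrow> 0) (at (0::real^'d::{finite,linorder}))" if "finite J" for J
    using that
  proof induction
    case (insert j J)
    let ?s = "\<lambda>t::real^'d::{finite,linorder}. \<Sum>j\<in>J. (t $ j) *\<^sub>R axis j (1::real)"
    have "((\<lambda>t::real^'d::{finite,linorder}. t $ j) \<longlongrightarrow> 0 $ j) (at 0)"
      by (intro tendsto_intros)
    then have "((\<lambda>t::real^'d::{finite,linorder}. \<psi> ((t $ j) *\<^sub>R axis j 1) a) \<longlongrightarrow> \<psi> (0 *\<^sub>R axis j 1) a) (at 0)"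
      using isCont_tendsto_compose[OF axis[of j]] by simp
    then have "((\<lambda>t::real^'d::{finite,linorder}. \<psi> ((t $ j) *\<^sub>R axis j 1) a - a) \<longlongrightarrow> 0) (at 0)"
      by (simp add: LIM_zero_iff)
    then have "((\<lambda>t::real^'d::{finite,linorder}. action_bound * norm (\<psi> ((t $ j) *\<^sub>R axis j 1) a - a)) \<longlongrightarrow> action_bound * norm (0::'a)) (at 0)"
      by (intro tendsto_intros)
    then have "((\<lambda>t. \<psi> (?s t) (\<psi> ((t $ j) *\<^sub>R axis j 1) a - a)) \<longlongrightarrow> 0) (at 0)"
      by - (rule Lim_null_comparison[rotated], simp, simp add: norm_action_le)
    from tendsto_add[OF this insert(3)] show ?case
      using insert(1,2) by (simp add: action_diff action_add_time[symmetric] add.commute)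
  qed simp
  from this[of UNIV] have lim: "((\<lambda>t. \<psi> (\<Sum>j\<in>UNIV. (t $ j) *\<^sub>R axis j 1) a - a) \<longlongrightarrow> 0) (at 0)"
    by simp
  have "((\<lambda>t. \<psi> t a - a) \<longlongrightarrow> 0) (at 0)"
  proof -
    have "(\<Sum>j\<in>UNIV. (t $ j) *\<^sub>R axis j 1) = t" for t :: "real^'d::{finite,linorder}"
      using basis_expansion[of t] by (simp add: scalar_mult_eq_scaleR)
    then show ?thesis using lim by simp
  qed
  then show ?thesis by (simp add: continuous_elements_def LIM_zero_iff)
qed

text \<open>The difference quotients are continuous elements, and these form a closed set.\<close>

lemma generator_continuous:
  assumes "a \<in> continuous_elements \<psi>" "a \<in> generator_dom \<psi> j"
  shows "generator \<psi> j a \<in> continuous_elements \<psi>"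
proof (rule Lim_in_closed_set[OF closed_continuous_elements _ _ tendsto_generator[OF assms(2)]])
  have "(1 / h) *\<^sub>R (\<psi> (h *\<^sub>R axis j 1) a - a) \<in> continuous_elements \<psi>" for h :: real
    unfolding scaleC_of_real[symmetric]
    by (intro continuous_elements_scaleC continuous_elements_diff continuous_elements_action assms)
  then show "\<forall>\<^sub>F h in at (0::real). (1 / h) *\<^sub>R (\<psi> (h *\<^sub>R axis j 1) a - a) \<in> continuous_elements \<psi>"
    by simp
qed simp

text \<open>The coefficient map is bounded on continuous elements, so it commutes with the limit of
  difference quotients; on the quotients it is explicit by covariance.\<close>

lemma fourier_coeff_generator:
  assumes a: "a \<in> continuous_elements \<psi>" "a \<in> generator_dom \<psi> j"
  shows "fourier_coeff \<psi> (generator \<psi> j a) k = scaleC (\<i> * of_real (2 * pi * real_of_int (k $ j))) (fourier_coeff \<psi> a k)"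
proof (rule tendsto_unique[of "at (0::real)"])
  let ?q = "\<lambda>h::real. (1 / h) *\<^sub>R (\<psi> (h *\<^sub>R axis j 1) a - a)"
  have q: "?q h \<in> continuous_elements \<psi>" for h
    unfolding scaleC_of_real[symmetric]
    by (intro continuous_elements_scaleC continuous_elements_diff continuous_elements_action a)
  have "((\<lambda>h. fourier_coeff \<psi> (?q h) k - fourier_coeff \<psi> (generator \<psi> j a) k) \<longlongrightarrow> 0) (at 0)"
  proof (rule Lim_null_comparison)
    show "\<forall>\<^sub>F h in at 0. norm (fourier_coeff \<psi> (?q h) k - fourier_coeff \<psi> (generator \<psi> j a) k)
        \<le> action_bound * norm (?q h - generator \<psi> j a)"
      using norm_fourier_coeff_le[OF continuous_elements_diff[OF q generator_continuous[OF a]]]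
      by (simp add: fourier_coeff_diff[OF q generator_continuous[OF a]])
    have "((\<lambda>h. action_bound * norm (?q h - generator \<psi> j a)) \<longlongrightarrow> action_bound * norm (generator \<psi> j a - generator \<psi> j a)) (at 0)"
      by (intro tendsto_intros tendsto_generator a)
    then show "((\<lambda>h. action_bound * norm (?q h - generator \<psi> j a)) \<longlongrightarrow> 0) (at 0)" by simp
  qed
  then show "((\<lambda>h. fourier_coeff \<psi> (?q h) k) \<longlongrightarrow> fourier_coeff \<psi> (generator \<psi> j a) k) (at 0)"
    by (simp add: LIM_zero_iff)
  \<comment> \<open>This includes h = 0, where division by zero makes both sides 0.\<close>
  have eq: "fourier_coeff \<psi> (?q h) k = scaleC ((cis (2 * pi * real_of_int (k $ j) * h) - 1) / of_real h) (fourier_coeff \<psi> a k)" for h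
  proof -
    have "fourier_coeff \<psi> (?q h) k = scaleC (of_real (1 / h))
        (fourier_coeff \<psi> (\<psi> (h *\<^sub>R axis j 1) a) k - fourier_coeff \<psi> a k)"
      unfolding scaleC_of_real[symmetric]
      by (simp only: fourier_coeff_scaleC fourier_coeff_diff continuous_elements_diff continuous_elements_action a)
    also have "fourier_coeff \<psi> (\<psi> (h *\<^sub>R axis j 1) a) k - fourier_coeff \<psi> a k
        = scaleC (cis (2 * pi * real_of_int (k $ j) * h) - 1) (fourier_coeff \<psi> a k)"
      using scaleC_add_left[of "cis (2 * pi * real_of_int (k $ j) * h) - 1" 1 "fourier_coeff \<psi> a k"]
      by (simp add: fourier_coeff_action[OF a(1)] character_scaled_axis)
    finally show ?thesis by (simp add: scaleC_scaleC)
  qed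
  show "((\<lambda>h. fourier_coeff \<psi> (?q h) k) \<longlongrightarrow> scaleC (\<i> * of_real (2 * pi * real_of_int (k $ j))) (fourier_coeff \<psi> a k)) (at 0)"
    unfolding eq by (intro tendsto_intros tendsto_cis_quotient)
qed simp

lemma fourier_coeff_generator_word:
  assumes "a \<in> continuous_elements \<psi>" "a \<in> generator_word_dom \<psi> w"
  shows "generator_word \<psi> w a \<in> continuous_elements \<psi> \<and>
    fourier_coeff \<psi> (generator_word \<psi> w a) k = scaleC (derivative_symbol w k) (fourier_coeff \<psi> a k)"
  using assms
  by (induction w) (auto simp: generator_continuous fourier_coeff_generator derivative_symbol_def scaleC_scaleC)

text \<open>The difference quotient of the sum differs from the termwise derivative by at most |h|
  S, where S is the sum of (2 pi |k|)^2 \<open>norm (b k)\<close>: the k-th error is controlled by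
  \<open>norm_cis_quotient\<close>.\<close>

lemma generator_eigen_series:
  assumes eig: "\<And>k. eigenvector k (b k)" and rap: "rapidly_decreasing b" and sum: "(b has_sum a) UNIV"
  shows "a \<in> generator_dom \<psi> j"
    and "((\<lambda>k. scaleC (derivative_symbol [j] k) (b k)) has_sum generator \<psi> j a) UNIV"
proof -
  let ?s = "\<lambda>k. derivative_symbol [j] k"
  obtain d where d: "((\<lambda>k. scaleC (?s k) (b k)) has_sum d) UNIV"
    using rapidly_decreasing_imp_summable[OF rapidly_decreasing_symbol[OF rap]] by (auto simp: summable_on_def)
  have "(\<lambda>k. (2 * pi)\<^sup>2 * (sup_norm_int k ^ 2 * norm (b k))) summable_on UNIV"
    using rap unfolding rapidly_decreasing_def by (intro summable_on_cmult_right) auto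
  then obtain S where S: "((\<lambda>k. (2 * pi)\<^sup>2 * (sup_norm_int k ^ 2 * norm (b k))) has_sum S) UNIV"
    by (auto simp: summable_on_def)
  have "((\<lambda>h. (1 / h) *\<^sub>R (\<psi> (h *\<^sub>R axis j 1) a - a) - d) \<longlongrightarrow> 0) (at 0)"
  proof (rule Lim_null_comparison)
    have "norm ((1 / h) *\<^sub>R (\<psi> (h *\<^sub>R axis j 1) a - a) - d) \<le> \<bar>h\<bar> * S" if "h \<noteq> 0" for h
    proof (rule norm_infsum_le)
      let ?c = "\<lambda>k. cis (2 * pi * real_of_int (k $ j) * h)"
      have "((\<lambda>k. (1 / h) *\<^sub>R (\<psi> (h *\<^sub>R axis j 1) (b k) - b k) - scaleC (?s k) (b k)) has_sum
          ((1 / h) *\<^sub>R (\<psi> (h *\<^sub>R axis j 1) a - a) - d)) UNIV"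
        by (rule has_sum_diff[OF has_sum_scaleR[OF has_sum_diff[OF has_sum_bounded_linear[OF bounded_linear_action sum] sum]] d])
      moreover have "(1 / h) *\<^sub>R (\<psi> (h *\<^sub>R axis j 1) (b k) - b k) - scaleC (?s k) (b k)
          = scaleC ((?c k - 1) / of_real h - ?s k) (b k)" for k
      proof -
        have "(1 / h) *\<^sub>R (\<psi> (h *\<^sub>R axis j 1) (b k) - b k) = scaleC ((?c k - 1) / of_real h) (b k)"
          using eig[of k] scaleC_add_left[of "?c k - 1" 1 "b k"]
          by (simp add: eigenvector_def character_scaled_axis scaleC_scaleC flip: scaleC_of_real)
        then show ?thesis
          using scaleC_add_left[of "(?c k - 1) / of_real h - ?s k" "?s k" "b k"] by simp
      qed
      ultimately show "((\<lambda>k. scaleC ((?c k - 1) / of_real h - ?s k) (b k)) has_sum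
          ((1 / h) *\<^sub>R (\<psi> (h *\<^sub>R axis j 1) a - a) - d)) UNIV" by simp
      show "((\<lambda>k. \<bar>h\<bar> * ((2 * pi)\<^sup>2 * (sup_norm_int k ^ 2 * norm (b k)))) has_sum \<bar>h\<bar> * S) UNIV"
        by (rule has_sum_cmult_right[OF S])
      fix k
      have "cmod ((?c k - 1) / of_real h - ?s k) \<le> (2 * pi * real_of_int (k $ j))\<^sup>2 * \<bar>h\<bar>"
        using norm_cis_quotient[OF that, of "2 * pi * real_of_int (k $ j)"] by (simp add: derivative_symbol_def)
      also have "\<dots> \<le> ((2 * pi)\<^sup>2 * sup_norm_int k ^ 2) * \<bar>h\<bar>"
      proof (rule mult_right_mono)
        have "(real_of_int (k $ j))\<^sup>2 \<le> (sup_norm_int k)\<^sup>2"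
          using abs_le_sup_norm_int[of k j] sup_norm_int_nonneg[of k] by (simp flip: abs_le_square_iff)
        then show "(2 * pi * real_of_int (k $ j))\<^sup>2 \<le> (2 * pi)\<^sup>2 * sup_norm_int k ^ 2"
          unfolding power_mult_distrib[of "2 * pi"] by (rule mult_left_mono) simp
      qed simp
      finally have "norm (scaleC ((?c k - 1) / of_real h - ?s k) (b k))
          \<le> ((2 * pi)\<^sup>2 * sup_norm_int k ^ 2) * \<bar>h\<bar> * norm (b k)"
        unfolding norm_scaleC by (rule mult_right_mono) simp
      then show "norm (scaleC ((?c k - 1) / of_real h - ?s k) (b k))
          \<le> \<bar>h\<bar> * ((2 * pi)\<^sup>2 * (sup_norm_int k ^ 2 * norm (b k)))"
        by (simp only: ac_simps)
    qed
    then show "\<forall>\<^sub>F h in at 0. norm ((1 / h) *\<^sub>R (\<psi> (h *\<^sub>R axis j 1) a - a) - d) \<le> \<bar>h\<bar> * S"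
      unfolding eventually_at by (intro exI[of _ 1]) auto
    have "((\<lambda>h::real. \<bar>h\<bar> * S) \<longlongrightarrow> \<bar>0\<bar> * S) (at 0)" by (intro tendsto_intros)
    then show "((\<lambda>h::real. \<bar>h\<bar> * S) \<longlongrightarrow> 0) (at 0)" by simp
  qed
  then have "((\<lambda>h. (1 / h) *\<^sub>R (\<psi> (h *\<^sub>R axis j 1) a - a)) \<longlongrightarrow> d) (at 0)"
    by (simp add: LIM_zero_iff)
  from generatorI[OF this] d show "a \<in> generator_dom \<psi> j"
    and "((\<lambda>k. scaleC (?s k) (b k)) has_sum generator \<psi> j a) UNIV"
    by simp_all
qed

lemma eigenvector_scaleC: "eigenvector k b \<Longrightarrow> eigenvector k (scaleC c b)"
  by (simp add: eigenvector_def action_scaleC scaleC_scaleC mult.commute)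

text \<open>The termwise derivative is again a rapidly decreasing series of eigenvectors, so the
  single-generator case can be iterated along the word.\<close>

lemma generator_word_eigen_series:
  assumes eig: "\<And>k. eigenvector k (b k)" and rap: "rapidly_decreasing b" and sum: "(b has_sum a) UNIV"
  shows "a \<in> generator_word_dom \<psi> w \<and>
    ((\<lambda>k. scaleC (derivative_symbol w k) (b k)) has_sum generator_word \<psi> w a) UNIV"
proof (induction w)
  case (Cons j w)
  let ?b = "\<lambda>k. scaleC (derivative_symbol w k) (b k)"
  have eq: "(\<lambda>k. scaleC (derivative_symbol [j] k) (?b k)) = (\<lambda>k. scaleC (derivative_symbol (j # w) k) (b k))"
    by (simp add: scaleC_scaleC derivative_symbol_def)
  note gen = generator_eigen_series[of ?b, OF eigenvector_scaleC[OF eig] rapidly_decreasing_symbol[OF rap] conjunct2[OF Cons], of j]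
  show ?case
    unfolding generator_word.simps generator_word_dom.simps mem_Collect_eq
    by (intro conjI conjunct1[OF Cons] gen(1) gen(2)[unfolded eq])
next
  case Nil
  show ?case using sum by (simp add: derivative_symbol_def)
qed

lemma smooth_eigen_series:
  assumes "\<And>k. eigenvector k (b k)" "rapidly_decreasing b" "(b has_sum a) UNIV"
  shows "a \<in> smooth_elements \<psi>"
    and "((\<lambda>k. scaleC (derivative_symbol (multi_word \<alpha>) k) (b k)) has_sum multi_deriv \<psi> \<alpha> a) UNIV"
  using conjunct1[OF generator_word_eigen_series[OF assms]] conjunct2[OF generator_word_eigen_series[OF assms]]
  unfolding smooth_elements_def multi_deriv_dom_def multi_deriv_def by blast+

end

section \<open>The associated function\<close>

lemma assoc_fun_ge: "ennreal (u ^ k / M k) \<le> assoc_fun M u"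
  unfolding assoc_fun_def by (rule SUP_upper) simp

lemma assoc_fun_mono:
  assumes "\<And>k. M k > 0" "0 \<le> u" "u \<le> v"
  shows "assoc_fun M u \<le> assoc_fun M v"
  unfolding assoc_fun_def using assms
  by (intro SUP_mono' ennreal_leI divide_right_mono power_mono less_imp_le[OF assms(1)])

lemma one_le_assoc_fun: "M 0 = 1 \<Longrightarrow> 1 \<le> assoc_fun M u"
  using assoc_fun_ge[of u 0 M] by simp

lemma assoc_fun_zero:
  assumes "M 0 = 1"
  shows "assoc_fun M 0 = 1"
proof (rule antisym)
  have "0 ^ k / M k \<le> 1" for k using assms by (cases k) auto
  then show "assoc_fun M 0 \<le> 1"
    unfolding assoc_fun_def by (intro SUP_least) (simp add: ennreal_le_1)
qed (rule one_le_assoc_fun[of M 0, OF assms])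

text \<open>An index shift: condition (M2') bounds u u^k / M_k by (c/h) (hu)^(k+1) / M_(k+1), a term
  of the supremum defining T_M(hu).\<close>

lemma mult_assoc_fun_le:
  assumes M: "\<And>k. M k > 0" "\<And>k. M (Suc k) \<le> c * h ^ k * M k" and "c > 0" "h > 0" "0 \<le> u"
  shows "ennreal u * assoc_fun M u \<le> ennreal (c / h) * assoc_fun M (h * u)"
  unfolding assoc_fun_def SUP_mult_left_ennreal
proof (rule SUP_least)
  fix k
  have "u * (u ^ k / M k) = u ^ Suc k / M k" by simp
  also have "\<dots> \<le> u ^ Suc k * (c * h ^ k / M (Suc k))"
    using M(1)[of k] M(1)[of "Suc k"] M(2)[of k] assms(5)
    by (simp add: divide_simps) (smt (verit) mult.assoc mult.commute mult_left_mono zero_le_mult_iff zero_le_power)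
  also have "\<dots> = c / h * ((h * u) ^ Suc k / M (Suc k))"
    using assms(4) by (simp add: field_simps power_mult_distrib)
  finally have "ennreal u * ennreal (u ^ k / M k) \<le> ennreal (c / h) * ennreal ((h * u) ^ Suc k / M (Suc k))"
    using assms M(1)[of k] M(1)[of "Suc k"]
    by (simp only: ennreal_mult[symmetric] less_imp_le divide_nonneg_pos zero_le_power mult_nonneg_nonneg) (rule ennreal_leI)
  also have "\<dots> \<le> (SUP i. ennreal (c / h) * ennreal ((h * u) ^ i / M i))"
    by (rule SUP_upper) simp
  finally show "ennreal u * ennreal (u ^ k / M k) \<le> (SUP i. ennreal (c / h) * ennreal ((h * u) ^ i / M i))" .
qed

lemma power_mult_assoc_fun_le:
  assumes M: "\<And>k. M k > 0" "\<And>k. M (Suc k) \<le> c * h ^ k * M k" and "c > 0" "h > 1" "0 \<le> u"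
  shows "ennreal (u ^ p) * assoc_fun M u \<le> ennreal ((c / h) ^ p) * assoc_fun M (h ^ p * u)"
proof (induction p)
  case (Suc p)
  let ?v = "h ^ p * u"
  \<comment> \<open>The induction hypothesis has already moved the argument of T_M to v = h^p u.
    Enlarging the next factor u to v, possible as h > 1, makes the one-step estimate applicable at
    v.\<close>
  have v: "0 \<le> ?v" "u \<le> ?v"
    using assms(4,5) by (auto simp: mult_le_cancel_right1 one_le_power)
  have ch: "0 \<le> c / h" using assms(3,4) by simp
  have "ennreal (u ^ Suc p) * assoc_fun M u = ennreal u * (ennreal (u ^ p) * assoc_fun M u)"
    using assms(5) by (simp add: ennreal_mult mult.assoc)
  also have "\<dots> \<le> ennreal ?v * (ennreal ((c / h) ^ p) * assoc_fun M ?v)"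
    by (rule mult_mono[OF ennreal_leI[OF v(2)] Suc]) auto
  also have "\<dots> = ennreal ((c / h) ^ p) * (ennreal ?v * assoc_fun M ?v)"
    by (simp add: ac_simps)
  also have "\<dots> \<le> ennreal ((c / h) ^ p) * (ennreal (c / h) * assoc_fun M (h * ?v))"
    using assms v by (intro mult_left_mono mult_assoc_fun_le) auto
  also have "\<dots> = ennreal ((c / h) ^ Suc p) * assoc_fun M (h ^ Suc p * u)"
  proof -
    have "ennreal ((c / h) ^ Suc p) = ennreal ((c / h) ^ p) * ennreal (c / h)"
      unfolding power_Suc2 using ch by (intro ennreal_mult) auto
    moreover have "h ^ Suc p * u = h * ?v" by simp
    ultimately show ?thesis by (simp only: mult.assoc)
  qed
  finally show ?case .
qed simp

text \<open>The scale s serves to recover |k| from the argument u of the weight; the factor (1 + s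
  u)^p is split into a constant and a pure power of u.\<close>

lemma one_plus_power_assoc_fun_le:
  assumes M: "\<And>k. M k > 0" "\<And>k. M (Suc k) \<le> c * h ^ k * M k" and "c > 0" "h > 1" "0 \<le> u" "0 < s"
  shows "ennreal ((1 + s * u) ^ p) * assoc_fun M u \<le> ennreal (2 ^ p * (1 + s ^ p * (c / h) ^ p)) * assoc_fun M (h ^ p * u)"
proof -
  have su: "0 \<le> s * u" using assms by simp
  \<comment> \<open>With x = s u: 1 + x \<le> 2 max 1 x, and the p-th power of max 1 x is at most 1
    + x^p.\<close>
  have "(1 + s * u) ^ p \<le> (2 * max 1 (s * u)) ^ p"
    using su by (intro power_mono) auto
  also have "\<dots> \<le> 2 ^ p * (1 + (s * u) ^ p)"
    using su by (auto simp: max_def power_mult_distrib zero_le_power[OF su, unfolded power_mult_distrib])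
  also have "\<dots> = 2 ^ p + 2 ^ p * s ^ p * u ^ p"
    by (simp add: power_mult_distrib algebra_simps)
  finally have "ennreal ((1 + s * u) ^ p) * assoc_fun M u \<le> ennreal (2 ^ p + 2 ^ p * s ^ p * u ^ p) * assoc_fun M u"
    by (intro mult_right_mono ennreal_leI) auto
  also have "\<dots> = ennreal (2 ^ p) * assoc_fun M u + ennreal (2 ^ p * s ^ p) * (ennreal (u ^ p) * assoc_fun M u)"
    using assms by (simp add: ennreal_plus ennreal_mult distrib_right mult.assoc del: ennreal_numeral)
  also have "\<dots> \<le> ennreal (2 ^ p) * assoc_fun M (h ^ p * u)
      + ennreal (2 ^ p * s ^ p) * (ennreal ((c / h) ^ p) * assoc_fun M (h ^ p * u))"
    using assms
    by (intro add_mono mult_left_mono power_mult_assoc_fun_le assoc_fun_mono)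
      (auto simp: mult_le_cancel_right1 one_le_power)
  also have "\<dots> = ennreal (2 ^ p + 2 ^ p * s ^ p * (c / h) ^ p) * assoc_fun M (h ^ p * u)"
    using assms by (simp add: ennreal_plus ennreal_mult distrib_right mult.assoc del: ennreal_numeral)
  finally show ?thesis by (simp add: algebra_simps)
qed

section \<open>Sums over the lattice\<close>

lemma sup_norm_int_attained: obtains j where "sup_norm_int k = \<bar>real_of_int (k $ j)\<bar>"
proof -
  have "Max (range (\<lambda>j. \<bar>k $ j\<bar>)) \<in> range (\<lambda>j. \<bar>k $ j\<bar>)" by (rule Max_in) auto
  then obtain j where "Max (range (\<lambda>j. \<bar>k $ j\<bar>)) = \<bar>k $ j\<bar>" by (rule rangeE)
  then show thesis using that[of j] unfolding sup_norm_int_def by (simp only: of_int_abs)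
qed

lemma sup_norm_int_le_iff: "sup_norm_int k \<le> x \<longleftrightarrow> (\<forall>j. \<bar>real_of_int (k $ j)\<bar> \<le> x)"
  using sup_norm_int_attained[of k] by (metis abs_le_sup_norm_int order_trans)

lemma sup_norm_int_nat: obtains m :: nat where "sup_norm_int k = real m"
  using sup_norm_int_attained[of k] by (metis of_int_abs of_nat_nat abs_ge_zero of_int_of_nat_eq)

lemma lattice_box_subset:
  "{k :: int^'d. sup_norm_int k \<le> real n} \<subseteq> vec_lambda ` (UNIV \<rightarrow>\<^sub>E {- int n..int n})"
proof
  fix k :: "int^'d" assume "k \<in> {k. sup_norm_int k \<le> real n}"
  then have "\<bar>real_of_int (k $ j)\<bar> \<le> real n" for j by (simp add: sup_norm_int_le_iff)
  then have "\<bar>k $ j\<bar> \<le> int n" for j by (metis of_int_abs of_int_le_iff of_int_of_nat_eq)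
  then have "($) k \<in> UNIV \<rightarrow>\<^sub>E {- int n..int n}" by (auto simp: PiE_iff abs_le_iff minus_le_iff)
  then show "k \<in> vec_lambda ` (UNIV \<rightarrow>\<^sub>E {- int n..int n})" by (metis image_eqI vec_nth_inverse)
qed

lemma finite_lattice_box: "finite {k :: int^'d. sup_norm_int k \<le> real n}"
  by (rule finite_subset[OF lattice_box_subset]) (intro finite_imageI finite_PiE, auto)

text \<open>The subtracted 2 / (n + 1) makes the induction close: the two new terms are each at most
  1 / ((n+1)(n+2)), which telescopes. At n = 0 there is equality.\<close>

lemma sum_inverse_squares_le: "(\<Sum>m\<in>{- int n..int n}. 1 / (1 + \<bar>real_of_int m\<bar>)\<^sup>2) \<le> 3 - 2 / (real n + 1)"
proof (induction n)
  case (Suc n)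
  have "{- int (Suc n)..int (Suc n)} = insert (- int (Suc n)) (insert (int (Suc n)) {- int n..int n})"
    by auto
  then have "(\<Sum>m\<in>{- int (Suc n)..int (Suc n)}. 1 / (1 + \<bar>real_of_int m\<bar>)\<^sup>2)
      = 2 / (real n + 2)\<^sup>2 + (\<Sum>m\<in>{- int n..int n}. 1 / (1 + \<bar>real_of_int m\<bar>)\<^sup>2)"
    by (simp add: add_ac)
  also have "\<dots> \<le> 2 / (real n + 2)\<^sup>2 + (3 - 2 / (real n + 1))" using Suc by simp
  also have "2 / (real n + 2)\<^sup>2 \<le> 2 / ((real n + 1) * (real n + 2))"
    unfolding power2_eq_square by (intro divide_left_mono mult_right_mono mult_pos_pos) auto
  also have "2 / ((real n + 1) * (real n + 2)) + (3 - 2 / (real n + 1)) = 3 - 2 / (real (Suc n) + 1)"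
    by (simp add: divide_simps) (simp add: algebra_simps)
  finally show ?case by simp
qed simp

text \<open>The exponent 2d gives each coordinate its own square: 1 + |k| dominates every 1 + |k_j|.
  After enlarging a finite set to a box, the sum of products factors into d one-dimensional sums,
  each at most 3.\<close>

lemma infsum_lattice_finite:
  "(\<Sum>\<^sub>\<infinity>k\<in>(UNIV :: (int^'d) set). ennreal (1 / (1 + sup_norm_int k) ^ (2 * CARD('d)))) \<le> ennreal (3 ^ CARD('d))"
  unfolding nonneg_infsum_complete[OF zero_le]
proof (rule SUP_least)
  fix F :: "(int^'d) set" assume "F \<in> {F. finite F \<and> F \<subseteq> UNIV}"
  then have F: "finite F" by simp
  define f :: "int \<Rightarrow> real" where "f m = 1 / (1 + \<bar>real_of_int m\<bar>)\<^sup>2" for m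
  obtain n :: nat where n: "\<And>k. k \<in> F \<Longrightarrow> sup_norm_int k \<le> real n"
  proof -
    obtain n :: nat where "Max (insert 0 (sup_norm_int ` F)) \<le> real n" using real_arch_simple by blast
    with F that show thesis by auto
  qed
  have le: "1 / (1 + sup_norm_int k) ^ (2 * CARD('d)) \<le> (\<Prod>j\<in>UNIV. f (k $ j))" for k :: "int^'d"
  proof -
    have "1 / (1 + sup_norm_int k) ^ (2 * CARD('d)) = (\<Prod>j\<in>(UNIV::'d set). 1 / (1 + sup_norm_int k)\<^sup>2)"
      by (simp add: power_mult power_divide)
    also have "\<dots> \<le> (\<Prod>j\<in>UNIV. f (k $ j))"
      unfolding f_def
      by (intro prod_mono conjI divide_left_mono power_mono add_left_mono abs_le_sup_norm_int
          mult_pos_pos zero_less_power add_pos_nonneg) (auto simp: sup_norm_int_nonneg)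
    finally show ?thesis .
  qed
  have "(\<Sum>k\<in>F. ennreal (1 / (1 + sup_norm_int k) ^ (2 * CARD('d)))) = ennreal (\<Sum>k\<in>F. 1 / (1 + sup_norm_int k) ^ (2 * CARD('d)))"
    by (intro sum_ennreal) (simp add: sup_norm_int_nonneg)
  also have "(\<Sum>k\<in>F. 1 / (1 + sup_norm_int k) ^ (2 * CARD('d))) \<le> (\<Sum>k\<in>F. \<Prod>j\<in>UNIV. f (k $ j))"
    by (intro sum_mono le)
  also have "\<dots> \<le> (\<Sum>k\<in>(vec_lambda ` (UNIV \<rightarrow>\<^sub>E {- int n..int n}) :: (int^'d) set). \<Prod>j\<in>UNIV. f (k $ j))"
  proof (rule sum_mono2)
    show "finite (vec_lambda ` (UNIV \<rightarrow>\<^sub>E {- int n..int n}) :: (int^'d) set)"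
      by (intro finite_imageI finite_PiE) auto
    show "F \<subseteq> vec_lambda ` (UNIV \<rightarrow>\<^sub>E {- int n..int n})"
      using n lattice_box_subset[of n] by auto
  qed (auto intro!: prod_nonneg simp: f_def)
  also have "\<dots> = (\<Sum>g\<in>(UNIV \<rightarrow>\<^sub>E {- int n..int n}). \<Prod>j\<in>(UNIV::'d set). f (g j))"
    by (subst sum.reindex) (auto simp: inj_on_def vec_lambda_inject)
  also have "\<dots> = (\<Prod>j\<in>(UNIV::'d set). \<Sum>m\<in>{- int n..int n}. f m)"
    by (rule prod_sum_PiE[symmetric]) auto
  also have "\<dots> \<le> (\<Prod>j\<in>(UNIV::'d set). 3)"
    using sum_inverse_squares_le[of n]
    by (intro prod_mono conjI sum_nonneg) (auto simp: f_def intro: order_trans)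
  finally show "(\<Sum>k\<in>F. ennreal (1 / (1 + sup_norm_int k) ^ (2 * CARD('d)))) \<le> ennreal (3 ^ CARD('d))"
    by (simp add: ennreal_leI)
qed

text \<open>The bridge from sums in \<open>ennreal\<close>, where weights may be infinite, to the
  real summability behind absolute convergence in the algebra.\<close>

lemma ennreal_infsum_finite:
  fixes f :: "'i \<Rightarrow> real"
  assumes f: "\<And>i. 0 \<le> f i" and fin: "(\<Sum>\<^sub>\<infinity>i\<in>UNIV. ennreal (f i)) < \<infinity>"
  shows "f summable_on UNIV" "ennreal (infsum f UNIV) = (\<Sum>\<^sub>\<infinity>i\<in>UNIV. ennreal (f i))"
proof -
  have eq: "(\<Sum>i\<in>F. ennreal (f i)) = ennreal (sum f F)" for F
    by (intro sum_ennreal f)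
  have S: "(\<Sum>\<^sub>\<infinity>i\<in>UNIV. ennreal (f i)) = (SUP F\<in>{F. finite F \<and> F \<subseteq> UNIV}. ennreal (sum f F))"
    unfolding eq[symmetric] by (rule nonneg_infsum_complete) simp
  show summ: "f summable_on UNIV"
  proof (rule nonneg_bdd_above_summable_on)
    show "bdd_above (sum f ` {F. F \<subseteq> UNIV \<and> finite F})"
    proof (rule bdd_aboveI2)
      fix F assume "F \<in> {F :: 'i set. F \<subseteq> UNIV \<and> finite F}"
      then have "ennreal (sum f F) \<le> (\<Sum>\<^sub>\<infinity>i\<in>UNIV. ennreal (f i))"
        unfolding S by (intro SUP_upper) auto
      then show "sum f F \<le> enn2real (\<Sum>\<^sub>\<infinity>i\<in>UNIV. ennreal (f i))"
        using fin by (metis enn2real_ennreal enn2real_mono f sum_nonneg infinity_ennreal_def)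
    qed
  qed (rule f)
  show "ennreal (infsum f UNIV) = (\<Sum>\<^sub>\<infinity>i\<in>UNIV. ennreal (f i))"
    unfolding S by (rule infsum_nonneg_is_SUPREMUM_ennreal[OF summ f])
qed

lemma infsum_mono_ennreal:
  fixes f g :: "'i \<Rightarrow> ennreal"
  shows "(\<And>i. f i \<le> g i) \<Longrightarrow> (\<Sum>\<^sub>\<infinity>i\<in>UNIV. f i) \<le> (\<Sum>\<^sub>\<infinity>i\<in>UNIV. g i)"
  by (intro infsum_mono nonneg_summable_on_complete) auto

lemma infsum_cmult_ennreal:
  fixes f :: "'i \<Rightarrow> ennreal"
  shows "(\<Sum>\<^sub>\<infinity>i\<in>UNIV. c * f i) = c * (\<Sum>\<^sub>\<infinity>i\<in>UNIV. f i)"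
  unfolding nonneg_infsum_complete[OF zero_le]
  by (simp add: SUP_mult_left_ennreal flip: sum_distrib_left)

lemma norm_has_sum_le_ennreal:
  fixes f :: "'i \<Rightarrow> 'a::real_normed_vector"
  assumes "(f has_sum s) UNIV"
  shows "ennreal (norm s) \<le> (\<Sum>\<^sub>\<infinity>i\<in>UNIV. ennreal (norm (f i)))"
proof (cases "(\<Sum>\<^sub>\<infinity>i\<in>UNIV. ennreal (norm (f i))) < \<infinity>")
  case True
  note summ = ennreal_infsum_finite[OF norm_ge_zero True]
  have "norm s \<le> infsum (\<lambda>i. norm (f i)) UNIV"
    by (rule norm_infsum_le[OF assms has_sum_infsum[OF summ(1)]]) simp
  then show ?thesis unfolding summ(2)[symmetric] by (rule ennreal_leI)
qed (simp add: not_less top_unique)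

section \<open>Comparison of the norms\<close>

lemma concat_replicate_single:
  "distinct xs \<Longrightarrow> concat (map (\<lambda>i. replicate (if i = j then n else 0) i) xs) = (if j \<in> set xs then replicate n j else [])"
  by (induction xs) auto

lemma multi_word_single:
  fixes j :: "'d::{finite,linorder}"
  shows "multi_word (\<lambda>i. if i = j then n else 0) = replicate n j"
  by (simp add: multi_word_def concat_replicate_single)

lemma multi_word_zero: "multi_word (\<lambda>i::'d::{finite,linorder}. 0) = []"
  by (simp add: multi_word_def)

lemma length_multi_word: "length (multi_word \<alpha>) = multi_order \<alpha>"
proof -
  have "length (multi_word \<alpha>) = sum_list (map \<alpha> (sorted_list_of_set UNIV))"
    by (simp add: multi_word_def length_concat comp_def)
  also have "\<dots> = multi_order \<alpha>"
    by (simp add: sum_list_distinct_conv_sum_set)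
  finally show ?thesis .
qed

context periodic_automorphism_group
begin

lemma one_le_action_bound: "1 \<le> action_bound"
  using norm_action_le[of 0 1] by (simp add: mult_le_cancel_right1 not_less)

lemma smooth_elements_continuous:
  assumes "a \<in> smooth_elements \<psi>"
  shows "a \<in> continuous_elements \<psi>"
proof (rule generator_domI_continuous)
  fix j
  have "a \<in> multi_deriv_dom \<psi> (\<lambda>i. if i = j then 1 else 0)"
    using assms unfolding smooth_elements_def by blast
  then show "a \<in> generator_dom \<psi> j"
    unfolding multi_deriv_dom_def multi_word_single by simp
qed

text \<open>Take \<alpha> = n e_j for a coordinate j where |k_j| is maximal. The symbol of this pure
  derivative then has modulus exactly (2 pi |k|)^n, so no dimension-dependent constant
  appears.\<close>

lemma fourier_coeff_smooth_bound:
  assumes a: "a \<in> smooth_elements \<psi>"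
  obtains \<alpha> where "multi_order \<alpha> = n"
    "(2 * pi * sup_norm_int k) ^ n * norm (fourier_coeff \<psi> a k) \<le> action_bound * norm (multi_deriv \<psi> \<alpha> a)"
proof -
  obtain j where j: "sup_norm_int k = \<bar>real_of_int (k $ j)\<bar>" by (rule sup_norm_int_attained)
  let ?\<alpha> = "\<lambda>i. if i = j then n else 0"
  have dom: "a \<in> generator_word_dom \<psi> (replicate n j)"
    using a unfolding smooth_elements_def multi_deriv_dom_def by (metis INT_D UNIV_I multi_word_single)
  have md: "multi_deriv \<psi> ?\<alpha> a = generator_word \<psi> (replicate n j) a"
    unfolding multi_deriv_def multi_word_single ..
  note fc = fourier_coeff_generator_word[OF smooth_elements_continuous[OF a] dom, of k]
  have "cmod (derivative_symbol (replicate n j) k) = (2 * pi * sup_norm_int k) ^ n"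
    by (induction n) (auto simp: derivative_symbol_def norm_mult j)
  then have "(2 * pi * sup_norm_int k) ^ n * norm (fourier_coeff \<psi> a k)
      = norm (fourier_coeff \<psi> (multi_deriv \<psi> ?\<alpha> a) k)"
    using fc by (simp add: md norm_scaleC)
  also have "\<dots> \<le> action_bound * norm (multi_deriv \<psi> ?\<alpha> a)"
    using fc by (intro norm_fourier_coeff_le) (simp add: md)
  finally show thesis by (intro that[of ?\<alpha>]) (simp_all add: sum.delta)
qed

section \<open>Inversion of rapidly decreasing Fourier series\<close>

lemma fourier_coeff_has_sum:
  assumes b: "\<And>k. b k \<in> continuous_elements \<psi>" and s: "(b has_sum s) UNIV" "s \<in> continuous_elements \<psi>"
  shows "((\<lambda>l. fourier_coeff \<psi> (b l) k) has_sum fourier_coeff \<psi> s k) UNIV"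
proof -
  have "((\<lambda>F. fourier_coeff \<psi> (sum b F) k - fourier_coeff \<psi> s k) \<longlongrightarrow> 0) (finite_subsets_at_top UNIV)"
  proof (rule Lim_null_comparison)
    show "\<forall>\<^sub>F F in finite_subsets_at_top UNIV. norm (fourier_coeff \<psi> (sum b F) k - fourier_coeff \<psi> s k)
        \<le> action_bound * norm (sum b F - s)"
    proof (intro always_eventually allI)
      fix F
      have F: "sum b F \<in> continuous_elements \<psi>" by (rule continuous_elements_sum[OF b])
      show "norm (fourier_coeff \<psi> (sum b F) k - fourier_coeff \<psi> s k) \<le> action_bound * norm (sum b F - s)"
        unfolding fourier_coeff_diff[OF F s(2), symmetric]
        by (rule norm_fourier_coeff_le[OF continuous_elements_diff[OF F s(2)]])
    qed
    have "((\<lambda>F. action_bound * norm (sum b F - s)) \<longlongrightarrow> action_bound * norm (s - s)) (finite_subsets_at_top UNIV)"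
      using s(1) unfolding has_sum_def by (intro tendsto_intros)
    then show "((\<lambda>F. action_bound * norm (sum b F - s)) \<longlongrightarrow> 0) (finite_subsets_at_top UNIV)" by simp
  qed
  then show ?thesis
    unfolding has_sum_def by (simp add: LIM_zero_iff fourier_coeff_sum[OF b])
qed

text \<open>The series converges to some s, which is smooth by termwise differentiation and hence
  continuous. By orthogonality s has the same coefficients as a, so uniqueness applies to a -
  s.\<close>

lemma fourier_inversion:
  assumes a: "a \<in> continuous_elements \<psi>" and rap: "rapidly_decreasing (fourier_coeff \<psi> a)"
  shows "(fourier_coeff \<psi> a has_sum a) UNIV"
proof -
  let ?b = "fourier_coeff \<psi> a"
  have eig: "eigenvector k (?b k)" for k by (rule eigenvector_fourier_coeff[OF a])
  obtain s where s: "(?b has_sum s) UNIV"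
    using rapidly_decreasing_imp_summable[OF rap] by (auto simp: summable_on_def)
  have sc: "s \<in> continuous_elements \<psi>"
    by (rule smooth_elements_continuous[OF smooth_eigen_series(1)[OF eig rap s]])
  have "fourier_coeff \<psi> (a - s) k = 0" for k
  proof -
    have "((\<lambda>l. fourier_coeff \<psi> (?b l) k) has_sum fourier_coeff \<psi> s k) UNIV"
      by (rule fourier_coeff_has_sum[OF eigenvector_imp_continuous[OF eig] s sc])
    moreover have "((\<lambda>l. fourier_coeff \<psi> (?b l) k) has_sum ?b k) UNIV"
    proof -
      have "((\<lambda>l. fourier_coeff \<psi> (?b l) k) has_sum (\<Sum>l\<in>{k}. fourier_coeff \<psi> (?b l) k)) {k}"
        by (rule has_sum_finite) simp
      then have "((\<lambda>l. fourier_coeff \<psi> (?b l) k) has_sum (\<Sum>l\<in>{k}. fourier_coeff \<psi> (?b l) k)) UNIV"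
        by (rule has_sum_cong_neutral[THEN iffD1, rotated -1]) (auto simp: fourier_coeff_eigenvector[OF eig])
      then show ?thesis by (simp add: fourier_coeff_eigenvector[OF eig])
    qed
    ultimately have "fourier_coeff \<psi> s k = ?b k" by (rule has_sum_unique)
    then show ?thesis by (simp add: fourier_coeff_diff[OF a sc])
  qed
  then have "a - s = 0" by (rule fourier_coeff_eq_zero_imp_zero[OF continuous_elements_diff[OF a sc]])
  with s show ?thesis by simp
qed

section \<open>Bandlimited elements and approximation errors\<close>

lemma bandlimited_continuous: "x \<in> bandlimited_space \<psi> n \<Longrightarrow> x \<in> continuous_elements \<psi>"
  by (auto simp: bandlimited_space_def bandlimited_def continuous_elements_zero smooth_elements_continuous split: if_splits)

text \<open>Derivatives of order m are O((2 pi n)^m) by bandlimitedness but at least a multiple of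
  (2 pi |k|)^m times the coefficient. The coefficient is therefore O((n/|k|)^m) for every m.\<close>

lemma fourier_coeff_bandlimited:
  assumes x: "x \<in> bandlimited_space \<psi> n" and k: "real n < sup_norm_int k"
  shows "fourier_coeff \<psi> x k = 0"
proof (cases "n = 0")
  case True
  with x show ?thesis by (simp add: bandlimited_space_def fourier_coeff_zero)
next
  case False
  let ?q = "real n / sup_norm_int k"
  from x False obtain C where C: "x \<in> smooth_elements \<psi>"
      "\<And>\<alpha>. norm (multi_deriv \<psi> \<alpha> x) \<le> C * (2 * pi * real n) ^ multi_order \<alpha>"
    by (auto simp: bandlimited_space_def bandlimited_def)
  have kpos: "0 < sup_norm_int k" using k of_nat_0_le_iff[of n] by linarith
  have "norm (fourier_coeff \<psi> x k) \<le> action_bound * C * ?q ^ m" for m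
  proof -
    obtain \<alpha> where \<alpha>: "multi_order \<alpha> = m"
      "(2 * pi * sup_norm_int k) ^ m * norm (fourier_coeff \<psi> x k) \<le> action_bound * norm (multi_deriv \<psi> \<alpha> x)"
      by (rule fourier_coeff_smooth_bound[OF C(1)])
    note \<alpha>(2)
    also have "action_bound * norm (multi_deriv \<psi> \<alpha> x) \<le> action_bound * (C * (2 * pi * real n) ^ m)"
      using C(2)[of \<alpha>] \<alpha>(1) action_bound_nonneg by (intro mult_left_mono) auto
    finally show ?thesis
      using kpos by (simp add: field_simps power_mult_distrib power_divide)
  qed
  moreover have "(\<lambda>m. action_bound * C * ?q ^ m) \<longlonglongrightarrow> action_bound * C * 0"
    using k kpos by (intro tendsto_intros LIMSEQ_realpow_zero) auto
  ultimately have "norm (fourier_coeff \<psi> x k) \<le> action_bound * C * 0"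
    by (intro LIMSEQ_le_const) auto
  then show ?thesis by simp
qed

lemma eigenvector_zero: "eigenvector k 0"
  by (simp add: eigenvector_def linear_0[OF bounded_linear.linear[OF bounded_linear_action]]
      linear_0[OF bounded_linear.linear[OF bounded_linear_scaleC_right]])

lemma smooth_elements_zero: "0 \<in> smooth_elements \<psi>"
  by (rule smooth_eigen_series[OF eigenvector_zero rapidly_decreasing_finite[of "{}"] has_sum_0]) auto

lemma multi_deriv_zero: "multi_deriv \<psi> \<alpha> 0 = 0"
  using smooth_elements_diff(2)[OF smooth_elements_zero smooth_elements_zero, of \<alpha>] by simp

lemma zero_bandlimited: "0 \<in> bandlimited_space \<psi> n"
  by (auto simp: bandlimited_space_def bandlimited_def smooth_elements_zero multi_deriv_zero intro!: exI[of _ 0])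

lemma approx_error_le: "x \<in> bandlimited_space \<psi> n \<Longrightarrow> approx_error \<psi> n a \<le> norm (a - x)"
  unfolding approx_error_def by (intro cINF_lower bdd_belowI2[of _ 0]) auto

lemma approx_error_greatest:
  "(\<And>x. x \<in> bandlimited_space \<psi> n \<Longrightarrow> c \<le> norm (a - x)) \<Longrightarrow> c \<le> approx_error \<psi> n a"
  unfolding approx_error_def using zero_bandlimited by (intro cINF_greatest) auto

lemma approx_error_zero: "approx_error \<psi> 0 a = norm a"
  by (simp add: approx_error_def bandlimited_space_def)

text \<open>Positivity of n matters: X_0 is {0}, whereas the box of radius 0 still contains the
  frequency 0.\<close>

lemma finite_eigen_sum_bandlimited:
  assumes eig: "\<And>k. eigenvector k (b k)" and "n > 0"
  shows "(\<Sum>k | sup_norm_int k \<le> real n. b k) \<in> bandlimited_space \<psi> n"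
proof -
  let ?K = "{k :: int^'d::{finite,linorder}. sup_norm_int k \<le> real n}"
  \<comment> \<open>Padding with zeros makes the finite sum a series over the whole lattice, to
    which termwise differentiation applies.\<close>
  define b' where "b' k = (if k \<in> ?K then b k else 0)" for k
  let ?x = "\<Sum>k\<in>?K. b k"
  have fin: "finite ?K" by (rule finite_lattice_box)
  have eig': "eigenvector k (b' k)" for k
    using eig by (simp add: b'_def eigenvector_zero)
  have rap: "rapidly_decreasing b'"
    by (rule rapidly_decreasing_finite[OF fin]) (auto simp: b'_def)
  have "(b' has_sum sum b' ?K) ?K" by (rule has_sum_finite[OF fin])
  then have "(b' has_sum sum b' ?K) UNIV"
    by (rule has_sum_cong_neutral[THEN iffD1, rotated -1]) (auto simp: b'_def)
  moreover have "sum b' ?K = ?x" by (intro sum.cong) (auto simp: b'_def)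
  ultimately have sum: "(b' has_sum ?x) UNIV" by simp
  note ser = smooth_eigen_series[OF eig' rap sum]
  have "norm (multi_deriv \<psi> \<alpha> ?x) \<le> (\<Sum>k\<in>?K. norm (b k)) * (2 * pi * real n) ^ multi_order \<alpha>" for \<alpha>
  proof (rule norm_infsum_le[OF ser(2)])
    let ?f = "\<lambda>k. norm (b' k) * (2 * pi * real n) ^ multi_order \<alpha>"
    have "(?f has_sum sum ?f ?K) ?K" by (rule has_sum_finite[OF fin])
    then have "(?f has_sum sum ?f ?K) UNIV"
      by (rule has_sum_cong_neutral[THEN iffD1, rotated -1]) (auto simp: b'_def)
    moreover have "sum ?f ?K = (\<Sum>k\<in>?K. norm (b k)) * (2 * pi * real n) ^ multi_order \<alpha>"
      unfolding sum_distrib_right by (intro sum.cong) (auto simp: b'_def)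
    ultimately show "(?f has_sum (\<Sum>k\<in>?K. norm (b k)) * (2 * pi * real n) ^ multi_order \<alpha>) UNIV" by simp
    fix k
    show "norm (scaleC (derivative_symbol (multi_word \<alpha>) k) (b' k)) \<le> ?f k"
    proof (cases "k \<in> ?K")
      case True
      have "cmod (derivative_symbol (multi_word \<alpha>) k) \<le> (2 * pi * sup_norm_int k) ^ multi_order \<alpha>"
        using norm_derivative_symbol_le[of "multi_word \<alpha>" k] by (simp add: length_multi_word)
      also have "\<dots> \<le> (2 * pi * real n) ^ multi_order \<alpha>"
        using True by (intro power_mono) (auto simp: sup_norm_int_nonneg)
      finally show ?thesis
        by (simp add: norm_scaleC mult.commute mult_left_mono)
    qed (simp add: b'_def norm_scaleC)
  qed
  then show ?thesis
    using ser(1) \<open>n > 0\<close> by (auto simp: bandlimited_space_def bandlimited_def)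
qed

end

lemma ennreal_mult3: "0 \<le> x \<Longrightarrow> 0 \<le> y \<Longrightarrow> 0 \<le> z \<Longrightarrow> ennreal (x * (y * z)) = ennreal x * (ennreal y * ennreal z)"
  by (simp add: ennreal_mult)

lemma ennreal_divide_le:
  assumes "0 < c" "0 \<le> x" "ennreal x \<le> ennreal c * y"
  shows "ennreal (x / c) \<le> y"
proof -
  have "ennreal (x / c) = ennreal (1 / c) * ennreal x"
    using assms(1,2) by (subst ennreal_mult[symmetric]) auto
  also have "\<dots> \<le> ennreal (1 / c) * (ennreal c * y)"
    by (intro mult_left_mono assms) simp
  also have "\<dots> = ennreal (1 / c * c) * y"
    using assms(1) by (subst ennreal_mult) (auto simp: mult.assoc)
  finally show ?thesis using assms(1) by simp
qed

locale carleman_setting = periodic_automorphism_group \<psi>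
  for \<psi> :: "real^'d::{finite,linorder} \<Rightarrow> 'a::complex_banach_algebra_1 \<Rightarrow> 'a" +
  fixes M :: "nat \<Rightarrow> real"
  assumes M_pos: "M k > 0" and M_zero: "M 0 = 1"
    and M_growth: "\<exists>c h. c > 0 \<and> h > 1 \<and> (\<forall>k. M (Suc k) \<le> c * h ^ k * M k)"
    and assoc_fun_finite: "\<exists>u>0. assoc_fun M u < \<infinity>"
begin

abbreviation "carleman \<equiv> carleman_norm \<psi> M"
abbreviation "fourier_1 r \<equiv> fourier_norm_1 \<psi> (lattice_weight M r)"
abbreviation "fourier_sup r \<equiv> fourier_norm_sup \<psi> (lattice_weight M r)"
abbreviation "approximation r \<equiv> approx_norm_sup \<psi> (nat_weight M r)"

section \<open>Inequalities between the four norms\<close>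

lemma norm_le_carleman: "ennreal (norm a) \<le> carleman r a"
proof (cases "a \<in> smooth_elements \<psi>")
  case True
  have "ennreal (norm (multi_deriv \<psi> (\<lambda>_. 0) a) / (r ^ multi_order (\<lambda>_::'d. 0) * M (multi_order (\<lambda>_::'d. 0)))) \<le> carleman r a"
    unfolding carleman_norm_def using True by (simp only: if_True) (rule SUP_upper, simp)
  then show ?thesis by (simp add: multi_deriv_def multi_word_zero M_zero)
qed (simp add: carleman_norm_def)

text \<open>Each term of the supremum defining the weight at k is matched with one derivative of
  order n, so the estimate holds with the same r.\<close>

lemma fourier_sup_le_carleman:
  assumes "r > 0"
  shows "fourier_sup r a \<le> ennreal action_bound * carleman r a"
proof (cases "a \<in> smooth_elements \<psi>")
  case False
  \<comment> \<open>The right side is infinite because \<open>action_bound\<close> is positive; 0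
    times infinity would be 0 in \<open>ennreal\<close>.\<close>
  then show ?thesis
    using one_le_action_bound by (simp add: carleman_norm_def ennreal_mult_top)
next
  case True
  have "ennreal (norm (fourier_coeff \<psi> a k)) * ennreal ((2 * pi * sup_norm_int k / r) ^ n / M n)
      \<le> ennreal action_bound * carleman r a" for k n
  proof -
    obtain \<alpha> where \<alpha>: "multi_order \<alpha> = n"
      "(2 * pi * sup_norm_int k) ^ n * norm (fourier_coeff \<psi> a k) \<le> action_bound * norm (multi_deriv \<psi> \<alpha> a)"
      by (rule fourier_coeff_smooth_bound[OF True])
    have "norm (fourier_coeff \<psi> a k) * ((2 * pi * sup_norm_int k / r) ^ n / M n)
        = ((2 * pi * sup_norm_int k) ^ n * norm (fourier_coeff \<psi> a k)) / (r ^ n * M n)"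
      by (simp add: power_divide)
    also have "\<dots> \<le> (action_bound * norm (multi_deriv \<psi> \<alpha> a)) / (r ^ n * M n)"
      using \<alpha>(2) assms M_pos[of n] by (intro divide_right_mono) auto
    finally have "ennreal (norm (fourier_coeff \<psi> a k) * ((2 * pi * sup_norm_int k / r) ^ n / M n))
        \<le> ennreal (action_bound * (norm (multi_deriv \<psi> \<alpha> a) / (r ^ n * M n)))"
      by (intro ennreal_leI) simp
    also have "\<dots> = ennreal action_bound * ennreal (norm (multi_deriv \<psi> \<alpha> a) / (r ^ n * M n))"
      using assms M_pos[of n] action_bound_nonneg by (intro ennreal_mult) auto
    also have "ennreal (norm (multi_deriv \<psi> \<alpha> a) / (r ^ n * M n)) \<le> carleman r a"
      unfolding carleman_norm_def \<alpha>(1)[symmetric] using True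
      by (simp only: if_True) (rule SUP_upper, simp)
    finally have "ennreal (norm (fourier_coeff \<psi> a k) * ((2 * pi * sup_norm_int k / r) ^ n / M n))
        \<le> ennreal action_bound * carleman r a"
      by (simp add: mult_left_mono)
    moreover have "0 \<le> (2 * pi * sup_norm_int k / r) ^ n / M n"
      using assms M_pos[of n] sup_norm_int_nonneg[of k] by simp
    ultimately show ?thesis by (simp only: ennreal_mult[OF norm_ge_zero])
  qed
  then show ?thesis
    using smooth_elements_continuous[OF True]
    by (simp add: fourier_norm_sup_def lattice_weight_def assoc_fun_def SUP_mult_left_ennreal SUP_le_iff)
qed

text \<open>Enlarging r to s = h^(2d) r gains a factor (1 + |k|)^(-2d) in the weight, whose sum over
  the lattice is at most 3^d.\<close>

lemma fourier_1_le_fourier_sup: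
  assumes "r > 0"
  shows "\<exists>s>0. \<exists>C>0. \<forall>a. fourier_1 s a \<le> ennreal C * fourier_sup r a"
proof -
  obtain c h where ch: "c > 0" "h > 1" "\<And>k. M (Suc k) \<le> c * h ^ k * M k"
    using M_growth by blast
  define p where "p = 2 * CARD('d)"
  define s where "s = h ^ p * r"
  \<comment> \<open>Chosen so that \<sigma> times the argument 2 pi |k| / s of T_M is |k|.\<close>
  define \<sigma> where "\<sigma> = s / (2 * pi)"
  define C where "C = 2 ^ p * (1 + \<sigma> ^ p * (c / h) ^ p)"
  have s: "s > 0" using ch assms by (simp add: s_def)
  then have \<sigma>: "\<sigma> > 0" by (simp add: \<sigma>_def)
  have C: "C > 0" using \<sigma> ch by (simp add: C_def add_pos_nonneg)
  let ?g = "\<lambda>k :: int^'d::{finite,linorder}. 1 / (1 + sup_norm_int k) ^ p"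
  have weight: "lattice_weight M s k \<le> ennreal (?g k) * (ennreal C * lattice_weight M r k)" for k :: "int^'d::{finite,linorder}"
  proof -
    let ?u = "2 * pi * sup_norm_int k / s"
    have u: "0 \<le> ?u" using s by (simp add: sup_norm_int_nonneg)
    have su: "\<sigma> * ?u = sup_norm_int k" using s by (simp add: \<sigma>_def)
    have hu: "h ^ p * ?u = 2 * pi * sup_norm_int k / r" using ch assms by (simp add: s_def)
    have pos: "0 < (1 + sup_norm_int k) ^ p" using sup_norm_int_nonneg[of k] by (intro zero_less_power) linarith
    have "lattice_weight M s k = ennreal (?g k) * (ennreal ((1 + sup_norm_int k) ^ p) * assoc_fun M ?u)"
    proof -
      have "ennreal (?g k) * ennreal ((1 + sup_norm_int k) ^ p) = ennreal (?g k * (1 + sup_norm_int k) ^ p)"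
        using pos by (intro ennreal_mult[symmetric]) auto
      also have "?g k * (1 + sup_norm_int k) ^ p = 1" using sup_norm_int_nonneg[of k] by simp
      finally show ?thesis by (simp add: lattice_weight_def mult.assoc[symmetric])
    qed
    also have "\<dots> \<le> ennreal (?g k) * (ennreal C * lattice_weight M r k)"
      using one_plus_power_assoc_fun_le[OF M_pos ch(3) ch(1,2) u \<sigma>, of p]
      unfolding su hu C_def lattice_weight_def by (rule mult_left_mono) simp
    finally show ?thesis .
  qed
  have "fourier_1 s a \<le> ennreal (3 ^ CARD('d) * C) * fourier_sup r a" for a
  proof (cases "a \<in> continuous_elements \<psi>")
    case False
    then show ?thesis using C by (simp add: fourier_norm_sup_def ennreal_mult_top)
  next
    case True
    have "fourier_1 s a = (\<Sum>\<^sub>\<infinity>k\<in>UNIV. ennreal (norm (fourier_coeff \<psi> a k)) * lattice_weight M s k)"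
      using True by (simp add: fourier_norm_1_def)
    also have "\<dots> \<le> (\<Sum>\<^sub>\<infinity>k\<in>UNIV. (ennreal C * fourier_sup r a) * ennreal (?g k))"
    proof (rule infsum_mono_ennreal)
      fix k
      have "ennreal (norm (fourier_coeff \<psi> a k)) * lattice_weight M s k
          \<le> ennreal (norm (fourier_coeff \<psi> a k)) * (ennreal (?g k) * (ennreal C * lattice_weight M r k))"
        by (intro mult_left_mono weight) simp
      also have "\<dots> = ennreal C * (ennreal (norm (fourier_coeff \<psi> a k)) * lattice_weight M r k) * ennreal (?g k)"
        by (simp only: ac_simps)
      also have "ennreal (norm (fourier_coeff \<psi> a k)) * lattice_weight M r k \<le> fourier_sup r a"
        unfolding fourier_norm_sup_def using True by (simp only: if_True) (rule SUP_upper, simp)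
      finally show "ennreal (norm (fourier_coeff \<psi> a k)) * lattice_weight M s k \<le> (ennreal C * fourier_sup r a) * ennreal (?g k)"
        by (simp add: mult_left_mono mult_right_mono)
    qed
    also have "\<dots> = (ennreal C * fourier_sup r a) * (\<Sum>\<^sub>\<infinity>k\<in>UNIV. ennreal (?g k))"
      by (rule infsum_cmult_ennreal)
    also have "\<dots> \<le> (ennreal C * fourier_sup r a) * ennreal (3 ^ CARD('d))"
      unfolding p_def by (intro mult_left_mono infsum_lattice_finite) simp
    also have "\<dots> = ennreal (3 ^ CARD('d) * C) * fourier_sup r a"
      using C by (simp add: ennreal_mult ac_simps)
    finally show ?thesis .
  qed
  then show ?thesis using s C by (intro exI[of _ s] conjI exI[of _ "3 ^ CARD('d) * C"]) auto
qed

lemma fourier_1_finite: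
  assumes "r > 0" and fin: "fourier_1 r a < \<infinity>"
  shows "a \<in> continuous_elements \<psi>" "rapidly_decreasing (fourier_coeff \<psi> a)"
    "fourier_1 r a = (\<Sum>\<^sub>\<infinity>k\<in>UNIV. ennreal (norm (fourier_coeff \<psi> a k)) * lattice_weight M r k)"
proof -
  show a: "a \<in> continuous_elements \<psi>"
    using fin by (auto simp: fourier_norm_1_def split: if_splits)
  then show eq: "fourier_1 r a = (\<Sum>\<^sub>\<infinity>k\<in>UNIV. ennreal (norm (fourier_coeff \<psi> a k)) * lattice_weight M r k)"
    by (simp add: fourier_norm_1_def)
  show "rapidly_decreasing (fourier_coeff \<psi> a)"
    unfolding rapidly_decreasing_def
  proof
    fix n
    \<comment> \<open>The n-th term of the supremum defining T_M gives |k|^n \<le>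
      \<open>?c * lattice_weight M r k\<close>; every polynomial moment is thus bounded by the
      C^1-norm.\<close>
    let ?c = "(r / (2 * pi)) ^ n * M n"
    have c: "?c \<ge> 0" using assms(1) M_pos[of n] by simp
    have "(\<Sum>\<^sub>\<infinity>k\<in>UNIV. ennreal (sup_norm_int k ^ n * norm (fourier_coeff \<psi> a k))) \<le> (\<Sum>\<^sub>\<infinity>k\<in>UNIV. ennreal ?c * (ennreal (norm (fourier_coeff \<psi> a k)) * lattice_weight M r k))"
    proof (rule infsum_mono_ennreal)
      fix k
      have "sup_norm_int k ^ n * norm (fourier_coeff \<psi> a k) = ?c * (norm (fourier_coeff \<psi> a k) * ((2 * pi * sup_norm_int k / r) ^ n / M n))"
        using assms(1) M_pos[of n] by (simp add: power_divide power_mult_distrib)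
      also have "ennreal \<dots> = ennreal ?c * (ennreal (norm (fourier_coeff \<psi> a k)) * ennreal ((2 * pi * sup_norm_int k / r) ^ n / M n))"
        using c assms(1) M_pos[of n] sup_norm_int_nonneg[of k] by (intro ennreal_mult3) auto
      also have "\<dots> \<le> ennreal ?c * (ennreal (norm (fourier_coeff \<psi> a k)) * lattice_weight M r k)"
        unfolding lattice_weight_def by (intro mult_left_mono assoc_fun_ge) auto
      finally show "ennreal (sup_norm_int k ^ n * norm (fourier_coeff \<psi> a k)) \<le> ennreal ?c * (ennreal (norm (fourier_coeff \<psi> a k)) * lattice_weight M r k)" .
    qed
    also have "\<dots> = ennreal ?c * fourier_1 r a"
      unfolding eq by (rule infsum_cmult_ennreal)
    also have "\<dots> < \<infinity>" using fin by (simp add: ennreal_mult_less_top)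
    finally show "(\<lambda>k. sup_norm_int k ^ n * norm (fourier_coeff \<psi> a k)) summable_on UNIV"
      by (intro ennreal_infsum_finite(1)) (simp_all add: sup_norm_int_nonneg)
  qed
qed

text \<open>In the differentiated Fourier series the symbol is at most (2 pi |k|)^n, hence at most
  r^n M_n times the weight at k. Dividing by r^n M_n leaves the C^1-norm with constant 1.\<close>

lemma carleman_le_fourier_1:
  assumes r: "r > 0"
  shows "carleman r a \<le> fourier_1 r a"
proof (cases "fourier_1 r a < \<infinity>")
  case True
  note fin = fourier_1_finite[OF r True]
  let ?b = "fourier_coeff \<psi> a"
  note ser = smooth_eigen_series[OF eigenvector_fourier_coeff[OF fin(1)] fin(2) fourier_inversion[OF fin(1,2)]]
  have "ennreal (norm (multi_deriv \<psi> \<alpha> a) / (r ^ multi_order \<alpha> * M (multi_order \<alpha>))) \<le> fourier_1 r a" for \<alpha>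
  proof -
    let ?n = "multi_order \<alpha>"
    let ?c = "r ^ ?n * M ?n"
    have c: "?c > 0" using r M_pos by simp
    have "ennreal (norm (multi_deriv \<psi> \<alpha> a)) \<le> (\<Sum>\<^sub>\<infinity>k\<in>UNIV. ennreal (norm (scaleC (derivative_symbol (multi_word \<alpha>) k) (?b k))))"
      by (rule norm_has_sum_le_ennreal[OF ser(2)])
    also have "\<dots> \<le> (\<Sum>\<^sub>\<infinity>k\<in>UNIV. ennreal ?c * (ennreal (norm (?b k)) * lattice_weight M r k))"
    proof (rule infsum_mono_ennreal)
      fix k
      have "norm (scaleC (derivative_symbol (multi_word \<alpha>) k) (?b k)) \<le> (2 * pi * sup_norm_int k) ^ ?n * norm (?b k)"
        unfolding norm_scaleC
        using norm_derivative_symbol_le[of "multi_word \<alpha>" k]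
        by (intro mult_right_mono) (simp_all add: length_multi_word)
      also have "\<dots> = ?c * (norm (?b k) * ((2 * pi * sup_norm_int k / r) ^ ?n / M ?n))"
        using r M_pos[of ?n] by (simp add: power_divide)
      finally have "ennreal (norm (scaleC (derivative_symbol (multi_word \<alpha>) k) (?b k)))
          \<le> ennreal (?c * (norm (?b k) * ((2 * pi * sup_norm_int k / r) ^ ?n / M ?n)))"
        by (rule ennreal_leI)
      also have "\<dots> = ennreal ?c * (ennreal (norm (?b k)) * ennreal ((2 * pi * sup_norm_int k / r) ^ ?n / M ?n))"
        using c r M_pos[of ?n] sup_norm_int_nonneg[of k] by (intro ennreal_mult3) auto
      also have "\<dots> \<le> ennreal ?c * (ennreal (norm (?b k)) * lattice_weight M r k)"
        unfolding lattice_weight_def by (intro mult_left_mono assoc_fun_ge) auto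
      finally show "ennreal (norm (scaleC (derivative_symbol (multi_word \<alpha>) k) (?b k)))
          \<le> ennreal ?c * (ennreal (norm (?b k)) * lattice_weight M r k)" .
    qed
    also have "\<dots> = ennreal ?c * fourier_1 r a"
      unfolding fin(3) by (rule infsum_cmult_ennreal)
    finally show ?thesis by (intro ennreal_divide_le c) simp_all
  qed
  then show ?thesis using ser(1) by (simp add: carleman_norm_def SUP_le_iff)
qed (simp add: not_less top_unique)

text \<open>The partial sum over the box of radius n is a competitor in X_n, and the remaining
  frequencies satisfy |k| \<ge> n. The weight at n is therefore at most the weight at each k of the
  tail.\<close>

lemma approximation_le_fourier_1:
  assumes r: "r > 0"
  shows "approximation r a \<le> fourier_1 r a"
proof (cases "fourier_1 r a < \<infinity>")
  case True
  note fin = fourier_1_finite[OF r True]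
  let ?b = "fourier_coeff \<psi> a"
  note sum = fourier_inversion[OF fin(1,2)]
  have "ennreal (approx_error \<psi> n a) * nat_weight M r n \<le> fourier_1 r a" for n
  proof -
    \<comment> \<open>At n = 0 the only competitor is 0, so the sum is empty and the tail is the
      whole series.\<close>
    let ?K = "if n = 0 then {} else {k :: int^'d::{finite,linorder}. sup_norm_int k \<le> real n}"
    have finK: "finite ?K" using finite_lattice_box by auto
    have x: "sum ?b ?K \<in> bandlimited_space \<psi> n"
      using finite_eigen_sum_bandlimited[of ?b n, OF eigenvector_fourier_coeff[OF fin(1)]]
      by (simp add: zero_bandlimited)
    let ?b' = "\<lambda>k. ?b k - (if k \<in> ?K then ?b k else 0)"
    have "((\<lambda>k. if k \<in> ?K then ?b k else 0) has_sum (\<Sum>k\<in>?K. if k \<in> ?K then ?b k else 0)) ?K"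
      by (rule has_sum_finite[OF finK])
    then have "((\<lambda>k. if k \<in> ?K then ?b k else 0) has_sum (\<Sum>k\<in>?K. if k \<in> ?K then ?b k else 0)) UNIV"
      by (rule has_sum_cong_neutral[THEN iffD1, rotated -1]) auto
    moreover have "(\<Sum>k\<in>?K. if k \<in> ?K then ?b k else 0) = sum ?b ?K" by (intro sum.cong) auto
    ultimately have tail: "(?b' has_sum (a - sum ?b ?K)) UNIV"
      by (intro has_sum_diff[OF sum]) simp
    have "ennreal (approx_error \<psi> n a) * nat_weight M r n \<le> (\<Sum>\<^sub>\<infinity>k\<in>UNIV. ennreal (norm (?b' k))) * nat_weight M r n"
      using order_trans[OF ennreal_leI[OF approx_error_le[OF x]] norm_has_sum_le_ennreal[OF tail]]
      by (rule mult_right_mono) simp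
    also have "\<dots> = (\<Sum>\<^sub>\<infinity>k\<in>UNIV. nat_weight M r n * ennreal (norm (?b' k)))"
      by (simp only: infsum_cmult_ennreal mult.commute)
    also have "\<dots> \<le> (\<Sum>\<^sub>\<infinity>k\<in>UNIV. ennreal (norm (?b k)) * lattice_weight M r k)"
    proof (rule infsum_mono_ennreal)
      fix k
      show "nat_weight M r n * ennreal (norm (?b' k)) \<le> ennreal (norm (?b k)) * lattice_weight M r k"
      proof (cases "k \<in> ?K")
        case False
        then have "real n \<le> sup_norm_int k"
          by (auto simp: sup_norm_int_nonneg split: if_splits)
        then have "nat_weight M r n \<le> lattice_weight M r k"
          unfolding nat_weight_def lattice_weight_def using r
          by (intro assoc_fun_mono M_pos divide_right_mono mult_left_mono) auto
        then have "nat_weight M r n * ennreal (norm (?b k)) \<le> lattice_weight M r k * ennreal (norm (?b k))"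
          by (rule mult_right_mono) simp
        then show ?thesis using False by (simp add: mult.commute)
      qed simp
    qed
    finally show ?thesis unfolding fin(3) .
  qed
  then show ?thesis by (simp add: approx_norm_sup_def SUP_le_iff)
qed (simp add: not_less top_unique)

lemma approx_error_nonneg: "0 \<le> approx_error \<psi> n a"
  by (rule approx_error_greatest) simp

text \<open>The weights grow at least linearly, so the errors tend to 0 and a is a norm limit of
  bandlimited elements. These are continuous, and the continuous elements are closed.\<close>

lemma approximation_finite_continuous:
  assumes r: "r > 0" and fin: "approximation r a < \<infinity>"
  shows "a \<in> continuous_elements \<psi>"
proof -
  obtain S where S: "approximation r a = ennreal S" "S \<ge> 0"
    using fin by (cases "approximation r a") auto
  \<comment> \<open>Keeps only the term of index 1 in the supremum defining T_M(2 pi n / r).\<close>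
  have bound: "approx_error \<psi> n a * (2 * pi * real n / (r * M 1)) \<le> S" for n
  proof -
    have "ennreal (approx_error \<psi> n a * (2 * pi * real n / (r * M 1)))
        = ennreal (approx_error \<psi> n a) * ennreal ((2 * pi * real n / r) ^ 1 / M 1)"
      using r M_pos[of 1] approx_error_nonneg[of n a]
      by (subst ennreal_mult[symmetric]) (auto simp del: One_nat_def)
    also have "\<dots> \<le> ennreal (approx_error \<psi> n a) * nat_weight M r n"
      unfolding nat_weight_def by (intro mult_left_mono assoc_fun_ge) simp
    also have "\<dots> \<le> ennreal S"
      unfolding S(1)[symmetric] approx_norm_sup_def by (rule SUP_upper) simp
    finally show ?thesis using S(2) by (simp add: ennreal_le_iff)
  qed
  have "\<exists>x\<in>continuous_elements \<psi>. dist x a < e" if "e > 0" for e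
  proof -
    obtain n :: nat where n: "S * r * M 1 / (2 * pi * e) < real n" "n > 0"
    proof -
      obtain n where "S * r * M 1 / (2 * pi * e) < real n" using reals_Archimedean2 by blast
      then show thesis by (intro that[of "Suc n"]) auto
    qed
    have "approx_error \<psi> n a < e"
    proof (rule ccontr)
      assume "\<not> approx_error \<psi> n a < e"
      then have "e * (2 * pi * real n / (r * M 1)) \<le> approx_error \<psi> n a * (2 * pi * real n / (r * M 1))"
        using r M_pos[of 1] by (intro mult_right_mono) auto
      with bound[of n] have "e * (2 * pi * real n / (r * M 1)) \<le> S" by linarith
      then show False using n r M_pos[of 1] that by (simp add: field_simps)
    qed
    then obtain x where "x \<in> bandlimited_space \<psi> n" "norm (a - x) < e"
      using approx_error_greatest[of n e a] by (meson not_less)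
    then show ?thesis
      using bandlimited_continuous by (auto simp: dist_norm norm_minus_commute)
  qed
  then show ?thesis
    using closed_approachable[OF closed_continuous_elements] by blast
qed

text \<open>Subtracting any x in X_n leaves the k-th coefficient unchanged, so the coefficient bound
  may be applied to a - x before taking the infimum.\<close>

lemma norm_fourier_coeff_le_approx_error:
  assumes a: "a \<in> continuous_elements \<psi>" and k: "real n < sup_norm_int k"
  shows "norm (fourier_coeff \<psi> a k) \<le> action_bound * approx_error \<psi> n a"
proof -
  have "norm (fourier_coeff \<psi> a k) / action_bound \<le> approx_error \<psi> n a"
  proof (rule approx_error_greatest)
    fix x assume x: "x \<in> bandlimited_space \<psi> n"
    have "norm (fourier_coeff \<psi> a k) = norm (fourier_coeff \<psi> (a - x) k)"
      using fourier_coeff_diff[OF a bandlimited_continuous[OF x]] fourier_coeff_bandlimited[OF x k] by simp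
    also have "\<dots> \<le> action_bound * norm (a - x)"
      by (intro norm_fourier_coeff_le continuous_elements_diff a bandlimited_continuous[OF x])
    finally show "norm (fourier_coeff \<psi> a k) / action_bound \<le> norm (a - x)"
      using one_le_action_bound by (simp add: divide_le_eq mult.commute)
  qed
  then show ?thesis using one_le_action_bound by (simp add: divide_le_eq mult.commute)
qed

text \<open>A coefficient with |k| = m is bounded by E_n only for n < m, so the best available error
  is E_(m-1). For m \<ge> 2 one has m \<le> 2 (m - 1), and s \<ge> 2r makes the weight at k at most
  the weight at m - 1.\<close>

lemma fourier_sup_le_approximation:
  assumes r: "r > 0"
  shows "\<exists>s>0. \<exists>C>0. \<forall>a. fourier_sup s a \<le> ennreal C * approximation r a"
proof -
  obtain u where u: "u > 0" "assoc_fun M u < \<infinity>" using assoc_fun_finite by blast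
  obtain T where T: "assoc_fun M u = ennreal T" "T \<ge> 0"
    using u(2) by (cases "assoc_fun M u") auto
  have T1: "T \<ge> 1" using one_le_assoc_fun[of M u, OF M_zero] T by simp
  define s where "s = max (2 * r) (2 * pi / u)"
  have s: "s > 0" "2 * r \<le> s" "2 * pi / s \<le> u"
    using r u by (auto simp: s_def max_def field_simps)
  define C where "C = action_bound * T"
  have C: "C > 0" "action_bound \<le> C"
    using one_le_action_bound T1 by (auto simp: C_def mult_le_cancel_left1)
  have "fourier_sup s a \<le> ennreal C * approximation r a" for a
  proof (cases "approximation r a < \<infinity>")
    case False
    then show ?thesis using C by (simp add: not_less top_unique ennreal_mult_top)
  next
    case True
    have a: "a \<in> continuous_elements \<psi>" by (rule approximation_finite_continuous[OF r True])
    have E: "ennreal (approx_error \<psi> n a) * nat_weight M r n \<le> approximation r a" for n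
      unfolding approx_norm_sup_def by (rule SUP_upper) simp
    have w0: "nat_weight M r 0 = 1"
      using assoc_fun_zero[of M, OF M_zero] by (simp add: nat_weight_def)
    have "ennreal (norm (fourier_coeff \<psi> a k)) * lattice_weight M s k \<le> ennreal C * approximation r a" for k
    proof -
      obtain m :: nat where m: "sup_norm_int k = real m" by (rule sup_norm_int_nat)
      consider "m \<le> 1" | "m \<ge> 2" by linarith
      then show ?thesis
      proof cases
        case 1 \<comment> \<open>\<open>E\<^sub>0\<close> is the only error available at \<open>m = 1\<close>, and its weight does not see \<open>T\<^sub>M\<close>;
          this is where \<open>s \<ge> 2\<pi>/u\<close> is needed.\<close>
        have "2 * pi * real m / s \<le> 2 * pi / s"
          using 1 s(1) by (intro divide_right_mono) auto
        then have "lattice_weight M s k \<le> ennreal T"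
          unfolding lattice_weight_def m T(1)[symmetric] using s
          by (intro assoc_fun_mono M_pos) auto
        then have "ennreal (norm (fourier_coeff \<psi> a k)) * lattice_weight M s k
            \<le> ennreal (action_bound * norm a) * ennreal T"
          by (intro mult_mono ennreal_leI norm_fourier_coeff_le a) auto
        also have "\<dots> = ennreal C * (ennreal (approx_error \<psi> 0 a) * nat_weight M r 0)"
          using action_bound_nonneg T(2) by (simp add: w0 approx_error_zero C_def ennreal_mult ac_simps)
        also have "\<dots> \<le> ennreal C * approximation r a"
          by (intro mult_left_mono E) simp
        finally show ?thesis .
      next
        case 2
        let ?n = "m - 1"
        have "real m \<le> 2 * real ?n" using 2 by (simp add: of_nat_diff)
        then have "real m / s \<le> 2 * real ?n / (2 * r)"
          using s r by (intro frac_le) auto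
        then have "real m / s \<le> real ?n / r" by simp
        then have w: "lattice_weight M s k \<le> nat_weight M r ?n"
          unfolding lattice_weight_def nat_weight_def m using s mult_left_mono[of "real m / s" "real ?n / r" "2 * pi"]
          by (intro assoc_fun_mono M_pos) auto
        have "ennreal (norm (fourier_coeff \<psi> a k)) * lattice_weight M s k
            \<le> ennreal (action_bound * approx_error \<psi> ?n a) * nat_weight M r ?n"
          using 2 w by (intro mult_mono ennreal_leI norm_fourier_coeff_le_approx_error a) (auto simp: m)
        also have "\<dots> = ennreal action_bound * (ennreal (approx_error \<psi> ?n a) * nat_weight M r ?n)"
          using action_bound_nonneg approx_error_nonneg by (simp add: ennreal_mult mult.assoc)
        also have "\<dots> \<le> ennreal C * approximation r a"
          by (intro mult_mono E ennreal_leI C) auto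
        finally show ?thesis .
      qed
    qed
    then show ?thesis using a by (simp add: fourier_norm_sup_def SUP_le_iff)
  qed
  then show ?thesis using s(1) C(1) by blast
qed

end

section \<open>Inductive limits of equivalent families of norms\<close>

text \<open>What the metric axioms on the finite part rest on. Symmetry N(-x) = N(x) follows from N
  0 = 0 and the inequality for differences.\<close>

definition extended_norm :: "('a::ab_group_add \<Rightarrow> ennreal) \<Rightarrow> bool" where
  "extended_norm N \<longleftrightarrow> N 0 = 0 \<and> (\<forall>x y. N (x - y) \<le> N x + N y) \<and> (\<forall>x. N x = 0 \<longrightarrow> x = 0)"

lemma Metric_space_extended_norm:
  assumes N: "extended_norm N"
  shows "Metric_space (finite_part N) (\<lambda>x y. enn2real (N (x - y)))"
proof
  have diff: "N (x - y) \<le> N x + N y" and zero: "N 0 = 0" and def: "N x = 0 \<Longrightarrow> x = 0" for x y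
    using N by (auto simp: extended_norm_def)
  have comm_le: "N (x - y) \<le> N (y - x)" for x y
    using diff[of 0 "y - x"] by (simp add: zero)
  then have comm: "N (x - y) = N (y - x)" for x y by (rule antisym) (rule comm_le)
  have tri: "N (x - z) \<le> N (x - y) + N (y - z)" for x y z
    using diff[of "x - y" "z - y"] comm[of z y] by simp
  have fin: "N (x - y) < \<infinity>" if "x \<in> finite_part N" "y \<in> finite_part N" for x y
    using that le_less_trans[OF diff[of x y]] by (simp add: finite_part_def)
  show "0 \<le> enn2real (N (x - y))" for x y by simp
  show "enn2real (N (x - y)) = enn2real (N (y - x))" for x y by (simp add: comm)
  show "enn2real (N (x - y)) = 0 \<longleftrightarrow> x = y" if "x \<in> finite_part N" "y \<in> finite_part N" for x y
    using fin[OF that] def[of "x - y"] by (auto simp: enn2real_eq_0_iff zero)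
  show "enn2real (N (x - z)) \<le> enn2real (N (x - y)) + enn2real (N (y - z))"
    if "x \<in> finite_part N" "y \<in> finite_part N" "z \<in> finite_part N" for x y z
    using enn2real_mono[OF tri[of x z y]] fin[OF that(1,2)] fin[OF that(2,3)]
    by (simp add: enn2real_plus)
qed

text \<open>A bounded inclusion: the N-ball of radius r / C lies in the N'-ball of radius r.\<close>

lemma continuous_map_norm_topology:
  assumes N: "extended_norm N" "extended_norm N'" and C: "0 < C" "\<And>a. N' a \<le> ennreal C * N a"
  shows "continuous_map (norm_topology N) (norm_topology N') id"
proof -
  interpret N: Metric_space "finite_part N" "\<lambda>x y. enn2real (N (x - y))"
    by (rule Metric_space_extended_norm[OF N(1)])
  interpret N': Metric_space "finite_part N'" "\<lambda>x y. enn2real (N' (x - y))"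
    by (rule Metric_space_extended_norm[OF N(2)])
  have diff: "N (x - y) \<le> N x + N y" for x y
    using N(1) by (auto simp: extended_norm_def)
  have sub: "x \<in> finite_part N'" if "x \<in> finite_part N" for x
    using that le_less_trans[OF C(2)[of x]] by (simp add: finite_part_def ennreal_mult_less_top)
  show ?thesis
    unfolding continuous_map_def norm_topology_def
  proof (intro conjI allI impI)
    show "id \<in> topspace N.mtopology \<rightarrow> topspace N'.mtopology" using sub by auto
    fix U assume U: "openin N'.mtopology U"
    show "openin N.mtopology {x \<in> topspace N.mtopology. id x \<in> U}"
      unfolding N.openin_mtopology
    proof (intro conjI allI impI)
      fix x assume x: "x \<in> {x \<in> topspace N.mtopology. id x \<in> U}"
      then obtain r where r: "r > 0" "N'.mball x r \<subseteq> U"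
        using U by (auto simp: N'.openin_mtopology)
      have "N.mball x (r / C) \<subseteq> {x \<in> topspace N.mtopology. id x \<in> U}"
      proof
        fix y assume "y \<in> N.mball x (r / C)"
        then have y: "x \<in> finite_part N" "y \<in> finite_part N" "enn2real (N (x - y)) < r / C"
          by auto
        have "N (x - y) < \<infinity>"
          using y(1,2) le_less_trans[OF diff[of x y]] by (simp add: finite_part_def)
        then have "enn2real (N' (x - y)) \<le> C * enn2real (N (x - y))"
          using enn2real_mono[OF C(2)[of "x - y"]] C(1) by (simp add: ennreal_mult_less_top enn2real_mult)
        also have "\<dots> < r" using y(3) C(1) by (simp add: field_simps)
        finally have "y \<in> N'.mball x r" using y sub by simp
        with r y(2) show "y \<in> {x \<in> topspace N.mtopology. id x \<in> U}" by auto
      qed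
      with r C(1) show "\<exists>r>0. N.mball x r \<subseteq> {x \<in> topspace N.mtopology. id x \<in> U}"
        by (intro exI[of _ "r / C"]) auto
    qed auto
  qed
qed

text \<open>Each step of the first inductive system embeds continuously into some step of the
  second; the index may change.\<close>

definition norm_family_dominates :: "'i set \<Rightarrow> ('i \<Rightarrow> 'a \<Rightarrow> ennreal) \<Rightarrow> ('i \<Rightarrow> 'a \<Rightarrow> ennreal) \<Rightarrow> bool" where
  "norm_family_dominates I N N' \<longleftrightarrow> (\<forall>i\<in>I. \<exists>j\<in>I. \<exists>C>0. \<forall>a. N' j a \<le> ennreal C * N i a)"

lemma norm_family_dominates_trans:
  assumes "norm_family_dominates I N N'" "norm_family_dominates I N' N''"
  shows "norm_family_dominates I N N''"
  unfolding norm_family_dominates_def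
proof
  fix i assume "i \<in> I"
  then obtain j C where j: "j \<in> I" "C > 0" "\<And>a. N' j a \<le> ennreal C * N i a"
    using assms(1) unfolding norm_family_dominates_def by blast
  then obtain k D where k: "k \<in> I" "D > 0" "\<And>a. N'' k a \<le> ennreal D * N' j a"
    using assms(2) unfolding norm_family_dominates_def by blast
  have "N'' k a \<le> ennreal (D * C) * N i a" for a
  proof -
    have "N'' k a \<le> ennreal D * (ennreal C * N i a)"
      using k(3) by (rule order_trans) (intro mult_left_mono j(3), simp)
    then show ?thesis using j(2) k(2) by (simp add: ennreal_mult mult.assoc)
  qed
  then show "\<exists>j\<in>I. \<exists>C>0. \<forall>a. N'' j a \<le> ennreal C * N i a"
    using j(2) k(1,2) by (intro bexI[of _ k] exI[of _ "D * C"]) auto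
qed

lemma norm_family_dominates_subset:
  assumes "norm_family_dominates I N N'"
  shows "(\<Union>i\<in>I. finite_part (N i)) \<subseteq> (\<Union>i\<in>I. finite_part (N' i))"
proof
  fix a assume "a \<in> (\<Union>i\<in>I. finite_part (N i))"
  then obtain i where i: "i \<in> I" "N i a < \<infinity>" by (auto simp: finite_part_def)
  then obtain j C where j: "j \<in> I" "N' j a \<le> ennreal C * N i a"
    using assms unfolding norm_family_dominates_def by blast
  have "N' j a < \<infinity>" using i(2) le_less_trans[OF j(2)] by (simp add: ennreal_mult_less_top)
  with j(1) show "a \<in> (\<Union>i\<in>I. finite_part (N' i))" by (auto simp: finite_part_def)
qed

lemma norm_family_dominates_continuous:
  assumes dom: "norm_family_dominates I N N'"
    and norms: "\<And>i. i \<in> I \<Longrightarrow> extended_norm (N i)" "\<And>i. i \<in> I \<Longrightarrow> extended_norm (N' i)"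
    and T: "\<forall>i\<in>I. continuous_map (norm_topology (N' i)) T id"
  shows "\<forall>i\<in>I. continuous_map (norm_topology (N i)) T id"
proof
  fix i assume i: "i \<in> I"
  then obtain j C where j: "j \<in> I" "C > 0" "\<And>a. N' j a \<le> ennreal C * N i a"
    using dom unfolding norm_family_dominates_def by blast
  have "continuous_map (norm_topology (N i)) (norm_topology (N' j)) id"
    by (rule continuous_map_norm_topology[OF norms(1)[OF i] norms(2)[OF j(1)] j(2,3)])
  from continuous_map_compose[OF this] T j(1)
  show "continuous_map (norm_topology (N i)) T id" by fastforce
qed

text \<open>The limit topology depends on the family only through the union of the steps and the set
  of topologies that make all inclusions continuous. Mutual domination preserves both.\<close>

lemma inductive_limit_topology_cong:
  assumes "norm_family_dominates I N N'" "norm_family_dominates I N' N"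
    and "\<And>i. i \<in> I \<Longrightarrow> extended_norm (N i)" "\<And>i. i \<in> I \<Longrightarrow> extended_norm (N' i)"
  shows "(\<Union>i\<in>I. finite_part (N i)) = (\<Union>i\<in>I. finite_part (N' i))"
    and "inductive_limit_topology I N = inductive_limit_topology I N'"
proof -
  show eq: "(\<Union>i\<in>I. finite_part (N i)) = (\<Union>i\<in>I. finite_part (N' i))"
    using assms(1,2) by (intro antisym norm_family_dominates_subset)
  have "(\<forall>i\<in>I. continuous_map (norm_topology (N i)) T id) \<longleftrightarrow> (\<forall>i\<in>I. continuous_map (norm_topology (N' i)) T id)" for T
    using norm_family_dominates_continuous[OF assms(1,3,4)] norm_family_dominates_continuous[OF assms(2,4,3)] by blast
  then show "inductive_limit_topology I N = inductive_limit_topology I N'"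
    unfolding inductive_limit_topology_def eq by simp
qed

section \<open>The four norms\<close>

context carleman_setting
begin

lemma carleman_diff_le:
  assumes r: "r > 0"
  shows "carleman r (a - b) \<le> carleman r a + carleman r b"
proof (cases "a \<in> smooth_elements \<psi> \<and> b \<in> smooth_elements \<psi>")
  case False
  then show ?thesis by (auto simp: carleman_norm_def)
next
  case True
  have "ennreal (norm (multi_deriv \<psi> \<alpha> (a - b)) / (r ^ multi_order \<alpha> * M (multi_order \<alpha>))) \<le> carleman r a + carleman r b" for \<alpha>
  proof -
    let ?c = "r ^ multi_order \<alpha> * M (multi_order \<alpha>)"
    have c: "0 \<le> ?c" using r M_pos[of "multi_order \<alpha>"] by simp
    have le: "ennreal (norm (multi_deriv \<psi> \<alpha> x) / ?c) \<le> carleman r x" if "x \<in> smooth_elements \<psi>" for x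
      unfolding carleman_norm_def using that by (simp only: if_True) (rule SUP_upper, simp)
    have "norm (multi_deriv \<psi> \<alpha> (a - b)) / ?c \<le> norm (multi_deriv \<psi> \<alpha> a) / ?c + norm (multi_deriv \<psi> \<alpha> b) / ?c"
      unfolding add_divide_distrib[symmetric] smooth_elements_diff(2)[OF conjunct1[OF True] conjunct2[OF True]]
      by (rule divide_right_mono[OF norm_triangle_ineq4 c])
    then have "ennreal (norm (multi_deriv \<psi> \<alpha> (a - b)) / ?c) \<le> ennreal (norm (multi_deriv \<psi> \<alpha> a) / ?c + norm (multi_deriv \<psi> \<alpha> b) / ?c)"
      by (rule ennreal_leI)
    also have "\<dots> = ennreal (norm (multi_deriv \<psi> \<alpha> a) / ?c) + ennreal (norm (multi_deriv \<psi> \<alpha> b) / ?c)"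
      by (intro ennreal_plus divide_nonneg_nonneg norm_ge_zero c)
    also have "\<dots> \<le> carleman r a + carleman r b" using True by (intro add_mono le) auto
    finally show ?thesis .
  qed
  moreover have "a - b \<in> smooth_elements \<psi>" using True by (simp add: smooth_elements_diff(1))
  ultimately have "(SUP \<alpha>. ennreal (norm (multi_deriv \<psi> \<alpha> (a - b)) / (r ^ multi_order \<alpha> * M (multi_order \<alpha>)))) \<le> carleman r a + carleman r b"
    by (intro SUP_least)
  with \<open>a - b \<in> smooth_elements \<psi>\<close> show ?thesis
    by (simp add: carleman_norm_def[of _ _ _ "a - b"])
qed

lemma ennreal_norm_fourier_coeff_diff_le:
  assumes "a \<in> continuous_elements \<psi>" "b \<in> continuous_elements \<psi>"
  shows "ennreal (norm (fourier_coeff \<psi> (a - b) k)) * w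
    \<le> ennreal (norm (fourier_coeff \<psi> a k)) * w + ennreal (norm (fourier_coeff \<psi> b k)) * w"
  unfolding fourier_coeff_diff[OF assms] distrib_right[symmetric] ennreal_plus[OF norm_ge_zero norm_ge_zero, symmetric]
  by (intro mult_right_mono ennreal_leI norm_triangle_ineq4) simp

lemma fourier_1_diff_le: "fourier_1 r (a - b) \<le> fourier_1 r a + fourier_1 r b"
proof (cases "a \<in> continuous_elements \<psi> \<and> b \<in> continuous_elements \<psi>")
  case False
  then show ?thesis by (auto simp: fourier_norm_1_def)
next
  case True
  then have "fourier_1 r (a - b) \<le> (\<Sum>\<^sub>\<infinity>k\<in>UNIV. ennreal (norm (fourier_coeff \<psi> a k)) * lattice_weight M r k
      + ennreal (norm (fourier_coeff \<psi> b k)) * lattice_weight M r k)"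
    by (simp only: fourier_norm_1_def continuous_elements_diff if_True)
      (intro infsum_mono_ennreal ennreal_norm_fourier_coeff_diff_le, auto)
  also have "\<dots> = fourier_1 r a + fourier_1 r b"
    using True by (simp only: fourier_norm_1_def if_True) (intro infsum_add nonneg_summable_on_complete, auto)
  finally show ?thesis .
qed

lemma fourier_sup_diff_le: "fourier_sup r (a - b) \<le> fourier_sup r a + fourier_sup r b"
proof (cases "a \<in> continuous_elements \<psi> \<and> b \<in> continuous_elements \<psi>")
  case False
  then show ?thesis by (auto simp: fourier_norm_sup_def)
next
  case True
  have le: "ennreal (norm (fourier_coeff \<psi> x k)) * lattice_weight M r k \<le> fourier_sup r x"
    if "x \<in> continuous_elements \<psi>" for x k
    unfolding fourier_norm_sup_def using that by (simp only: if_True) (rule SUP_upper, simp)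
  have "ennreal (norm (fourier_coeff \<psi> (a - b) k)) * lattice_weight M r k \<le> fourier_sup r a + fourier_sup r b" for k
    using True by (intro order_trans[OF ennreal_norm_fourier_coeff_diff_le] add_mono le) auto
  then have "(SUP k. ennreal (norm (fourier_coeff \<psi> (a - b) k)) * lattice_weight M r k) \<le> fourier_sup r a + fourier_sup r b"
    by (intro SUP_least)
  with True show ?thesis
    by (simp add: fourier_norm_sup_def[of _ _ "a - b"] continuous_elements_diff)
qed

lemma bandlimited_space_diff:
  assumes "x \<in> bandlimited_space \<psi> n" "y \<in> bandlimited_space \<psi> n"
  shows "x - y \<in> bandlimited_space \<psi> n"
proof (cases "n = 0")
  case False
  with assms obtain C D where
    C: "x \<in> smooth_elements \<psi>" "\<And>\<alpha>. norm (multi_deriv \<psi> \<alpha> x) \<le> C * (2 * pi * real n) ^ multi_order \<alpha>" and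
    D: "y \<in> smooth_elements \<psi>" "\<And>\<alpha>. norm (multi_deriv \<psi> \<alpha> y) \<le> D * (2 * pi * real n) ^ multi_order \<alpha>"
    by (auto simp: bandlimited_space_def bandlimited_def)
  have "norm (multi_deriv \<psi> \<alpha> (x - y)) \<le> (C + D) * (2 * pi * real n) ^ multi_order \<alpha>" for \<alpha>
    unfolding smooth_elements_diff(2)[OF C(1) D(1)] distrib_right
    by (rule order_trans[OF norm_triangle_ineq4 add_mono[OF C(2) D(2)]])
  then have "bandlimited \<psi> (real n) (x - y)"
    unfolding bandlimited_def using smooth_elements_diff(1)[OF C(1) D(1)] by blast
  with False show ?thesis by (simp add: bandlimited_space_def)
qed (use assms in \<open>simp add: bandlimited_space_def\<close>)

text \<open>X_n is closed under differences, so x - y competes for a - b whenever x competes for a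
  and y for b. The two infima are taken one after the other.\<close>

lemma approx_error_diff_le: "approx_error \<psi> n (a - b) \<le> approx_error \<psi> n a + approx_error \<psi> n b"
proof -
  have "approx_error \<psi> n (a - b) - approx_error \<psi> n b \<le> approx_error \<psi> n a"
  proof (rule approx_error_greatest)
    fix x assume x: "x \<in> bandlimited_space \<psi> n"
    have "approx_error \<psi> n (a - b) - norm (a - x) \<le> approx_error \<psi> n b"
    proof (rule approx_error_greatest)
      fix y assume "y \<in> bandlimited_space \<psi> n"
      from approx_error_le[OF bandlimited_space_diff[OF x this], of "a - b"]
      have "approx_error \<psi> n (a - b) \<le> norm ((a - x) - (b - y))" by (simp add: algebra_simps)
      also have "\<dots> \<le> norm (a - x) + norm (b - y)" by (rule norm_triangle_ineq4)
      finally show "approx_error \<psi> n (a - b) - norm (a - x) \<le> norm (b - y)" by simp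
    qed
    then show "approx_error \<psi> n (a - b) - approx_error \<psi> n b \<le> norm (a - x)" by simp
  qed
  then show ?thesis by simp
qed

lemma approximation_diff_le: "approximation r (a - b) \<le> approximation r a + approximation r b"
proof -
  have le: "ennreal (approx_error \<psi> n x) * nat_weight M r n \<le> approximation r x" for x n
    unfolding approx_norm_sup_def by (rule SUP_upper) simp
  have "ennreal (approx_error \<psi> n (a - b)) * nat_weight M r n \<le> approximation r a + approximation r b" for n
  proof -
    have "ennreal (approx_error \<psi> n (a - b)) * nat_weight M r n
        \<le> ennreal (approx_error \<psi> n a + approx_error \<psi> n b) * nat_weight M r n"
      by (intro mult_right_mono ennreal_leI approx_error_diff_le) simp
    also have "\<dots> = ennreal (approx_error \<psi> n a) * nat_weight M r n + ennreal (approx_error \<psi> n b) * nat_weight M r n"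
      by (simp add: ennreal_plus approx_error_nonneg distrib_right)
    also have "\<dots> \<le> approximation r a + approximation r b" by (intro add_mono le)
    finally show ?thesis .
  qed
  then show ?thesis unfolding approx_norm_sup_def[of _ _ "a - b"] by (intro SUP_least)
qed

lemma approx_error_of_zero: "approx_error \<psi> n 0 = 0"
  using approx_error_le[OF zero_bandlimited, of n 0] approx_error_nonneg[of n 0] by simp

section \<open>Mutual domination of the four families and equality of the limits\<close>

lemma dominates_fourier_sup_carleman: "norm_family_dominates {0<..} carleman fourier_sup"
  unfolding norm_family_dominates_def
proof
  fix r :: real assume "r \<in> {0<..}"
  then show "\<exists>s\<in>{0<..}. \<exists>C>0. \<forall>a. fourier_sup s a \<le> ennreal C * carleman r a"
    using fourier_sup_le_carleman[of r] one_le_action_bound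
    by (intro bexI[of _ r] exI[of _ action_bound]) auto
qed

lemma dominates_fourier_1_fourier_sup: "norm_family_dominates {0<..} fourier_sup fourier_1"
  unfolding norm_family_dominates_def using fourier_1_le_fourier_sup by (fastforce simp: Bex_def)

lemma dominates_carleman_fourier_1: "norm_family_dominates {0<..} fourier_1 carleman"
  unfolding norm_family_dominates_def
proof
  fix r :: real assume "r \<in> {0<..}"
  then show "\<exists>s\<in>{0<..}. \<exists>C>0. \<forall>a. carleman s a \<le> ennreal C * fourier_1 r a"
    using carleman_le_fourier_1[of r] by (intro bexI[of _ r] exI[of _ 1]) auto
qed

lemma dominates_approximation_fourier_1: "norm_family_dominates {0<..} fourier_1 approximation"
  unfolding norm_family_dominates_def
proof
  fix r :: real assume "r \<in> {0<..}"
  then show "\<exists>s\<in>{0<..}. \<exists>C>0. \<forall>a. approximation s a \<le> ennreal C * fourier_1 r a"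
    using approximation_le_fourier_1[of r] by (intro bexI[of _ r] exI[of _ 1]) auto
qed

lemma dominates_fourier_sup_approximation: "norm_family_dominates {0<..} approximation fourier_sup"
  unfolding norm_family_dominates_def using fourier_sup_le_approximation by (fastforce simp: Bex_def)

text \<open>In these names the first norm is bounded by the second. The basic estimates form two
  cycles, Carleman to C^infinity to C^1 to Carleman and C^1 to approximation to C^infinity to C^1;
  the four compositions here relate the Carleman family to the others.\<close>

lemmas dominates_fourier_1_carleman =
  norm_family_dominates_trans[OF dominates_fourier_sup_carleman dominates_fourier_1_fourier_sup]
lemmas dominates_carleman_fourier_sup =
  norm_family_dominates_trans[OF dominates_fourier_1_fourier_sup dominates_carleman_fourier_1]
lemmas dominates_approximation_carleman =
  norm_family_dominates_trans[OF dominates_fourier_1_carleman dominates_approximation_fourier_1]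
lemmas dominates_carleman_approximation =
  norm_family_dominates_trans[OF dominates_fourier_sup_approximation dominates_carleman_fourier_sup]

text \<open>The Carleman norm dominates the norm of the algebra through \<alpha> = 0. Any family
  that bounds the Carleman family thereby inherits definiteness, which is how the other three norms
  obtain it.\<close>

lemma definite_of_dominates_carleman:
  assumes "norm_family_dominates {0<..} N carleman" "r > 0" "N r a = 0"
  shows "a = 0"
proof -
  obtain s C where "carleman s a \<le> ennreal C * N r a"
    using assms(1,2) unfolding norm_family_dominates_def by blast
  with norm_le_carleman[of a s] assms(3) have "ennreal (norm a) \<le> 0" by simp
  then show ?thesis by simp
qed

lemma extended_norm_carleman: "r > 0 \<Longrightarrow> extended_norm (carleman r)"
  using norm_le_carleman[of _ r]
  by (auto simp: extended_norm_def carleman_diff_le carleman_norm_def[of _ _ _ 0] smooth_elements_zero multi_deriv_zero)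
    (metis ennreal_eq_0_iff le_zero_eq norm_le_zero_iff)

lemma extended_norm_fourier_1: "r > 0 \<Longrightarrow> extended_norm (fourier_1 r)"
  unfolding extended_norm_def
  using definite_of_dominates_carleman[OF dominates_carleman_fourier_1] fourier_1_diff_le
  by (auto simp: fourier_norm_1_def[of _ _ 0] continuous_elements_zero fourier_coeff_zero)

lemma extended_norm_fourier_sup: "r > 0 \<Longrightarrow> extended_norm (fourier_sup r)"
  unfolding extended_norm_def
  using definite_of_dominates_carleman[OF dominates_carleman_fourier_sup] fourier_sup_diff_le
  by (auto simp: fourier_norm_sup_def[of _ _ 0] continuous_elements_zero fourier_coeff_zero)

lemma extended_norm_approximation: "r > 0 \<Longrightarrow> extended_norm (approximation r)"
  unfolding extended_norm_def
  using definite_of_dominates_carleman[OF dominates_carleman_approximation] approximation_diff_le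
  by (auto simp: approx_norm_sup_def[of _ _ 0] approx_error_of_zero)

lemma carleman_class_characterizations:
  "carleman_class \<psi> M = (\<Union>r\<in>{0<..}. finite_part (fourier_1 r))"
  "carleman_class \<psi> M = (\<Union>r\<in>{0<..}. finite_part (fourier_sup r))"
  "carleman_class \<psi> M = (\<Union>r\<in>{0<..}. finite_part (approximation r))"
  "inductive_limit_topology {0<..} carleman = inductive_limit_topology {0<..} fourier_1"
  "inductive_limit_topology {0<..} carleman = inductive_limit_topology {0<..} fourier_sup"
  "inductive_limit_topology {0<..} carleman = inductive_limit_topology {0<..} approximation"
  unfolding carleman_class_def
  by (intro inductive_limit_topology_cong dominates_fourier_1_carleman dominates_carleman_fourier_1
      dominates_fourier_sup_carleman dominates_carleman_fourier_sup
      dominates_approximation_carleman dominates_carleman_approximation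
      extended_norm_carleman extended_norm_fourier_1 extended_norm_fourier_sup extended_norm_approximation; simp)+

end

theorem proposition24:
  fixes \<psi> :: "real^'d::{finite,linorder} \<Rightarrow> 'a::complex_banach_algebra_1 \<Rightarrow> 'a"
    and M :: "nat \<Rightarrow> real"
  assumes "automorphism_group \<psi>"
    and "periodic_group \<psi>"
    and "\<forall>k. M k > 0"
    and "M 0 = 1"
    and "\<exists>c h. c > 0 \<and> h > 1 \<and> (\<forall>k. M (Suc k) \<le> c * h ^ k * M k)"
    and "\<exists>u>0. assoc_fun M u < \<infinity>"
  shows "(carleman_class \<psi> M = (\<Union>r\<in>{0<..}. finite_part (fourier_norm_1 \<psi> (lattice_weight M r)))) \<and>
     (carleman_class \<psi> M = (\<Union>r\<in>{0<..}. finite_part (fourier_norm_sup \<psi> (lattice_weight M r)))) \<and>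
     (carleman_class \<psi> M = (\<Union>r\<in>{0<..}. finite_part (approx_norm_sup \<psi> (nat_weight M r)))) \<and>
     (inductive_limit_topology {0<..} (carleman_norm \<psi> M) =
         inductive_limit_topology {0<..} (\<lambda>r. fourier_norm_1 \<psi> (lattice_weight M r))) \<and>
     (inductive_limit_topology {0<..} (carleman_norm \<psi> M) =
         inductive_limit_topology {0<..} (\<lambda>r. fourier_norm_sup \<psi> (lattice_weight M r))) \<and>
     (inductive_limit_topology {0<..} (carleman_norm \<psi> M) =
         inductive_limit_topology {0<..} (\<lambda>r. approx_norm_sup \<psi> (nat_weight M r)))"
proof -
  interpret carleman_setting \<psi> M
    using assms by unfold_locales auto
  show ?thesis by (intro conjI carleman_class_characterizations)
qed

end
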